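(* Let $\mathcal{F}$ be a family of regular scattered $P$-spaces of weight $\omega_1$ with countable Cantor--Bendixson ranks. Then in $(\mathcal{F},\subset_h)$ every antichain is finite and every strictly decreasing chain is finite.
   Context: A topological space is a $P$-space if all its $G_\delta$ subsets are open; regular spaces are assumed to be $T_1$. A space is scattered if every non-empty subspace has an isolated point. $X^{(\alpha)}$ is the $\alpha$-th Cantor--Bendixson derivative of $X$, and for scattered $X$ the Cantor--Bendixson rank $N(X)$ is the least ordinal with $X^{(N(X))}=\emptyset$. $X\subset_hY$ means that $X$ is homeomorphic to a subspace of $Y$; $X=_hY$ means $X\subset_hY$ and $Y\subset_hX$, and spaces with $X=_hY$ are identified when $\subset_h$ is regarded as an order. An antichain is a set of spaces any two distinct members $X,Y$ of which satisfy neither $X\subset_hY$ nor $Y\subset_hX$. A strictly decreasing chain is a sequence $X_1,X_2,\ldots$ with $X_{k+1}\subset_hX_k$ and not $X_{k+1}=_hX_k$ for each $k$. *)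

theory Defs
  imports "HOL-Analysis.Analysis"
begin

unbundle cardinal_syntax
no_notation elt_set_eq  (infix "=o" 50)

definition embeds :: "'a topology \<Rightarrow> 'b topology \<Rightarrow> bool" (infix "embeds'_in" 50) where
  "X embeds_in Y \<longleftrightarrow> (\<exists>S. S \<subseteq> topspace Y \<and> X homeomorphic_space subtopology Y S)"

definition biembeddable :: "'a topology \<Rightarrow> 'b topology \<Rightarrow> bool" where
  "biembeddable X Y \<longleftrightarrow> X embeds_in Y \<and> Y embeds_in X"

definition P_space :: "'a topology \<Rightarrow> bool" where
  "P_space X \<longleftrightarrow> (\<forall>S. gdelta_in X S \<longrightarrow> openin X S)"

definition isolated_points :: "'a topology \<Rightarrow> 'a set" where
  "isolated_points X = {x \<in> topspace X. openin X {x}}"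

definition scattered :: "'a topology \<Rightarrow> bool" where
  "scattered X \<longleftrightarrow>
     (\<forall>S \<subseteq> topspace X. S \<noteq> {} \<longrightarrow> isolated_points (subtopology X S) \<noteq> {})"


section \<open>Weight\<close>

definition base_of :: "'a topology \<Rightarrow> 'a set set \<Rightarrow> bool" where
  "base_of X \<B> \<longleftrightarrow> (\<forall>V \<in> \<B>. openin X V) \<and>
     (\<forall>U x. openin X U \<and> x \<in> U \<longrightarrow> (\<exists>V \<in> \<B>. x \<in> V \<and> V \<subseteq> U))"

text \<open>Cardinals are the (chosen) well-orders of the HOL cardinal library and are determined only up
  to \<open>=o\<close>.\<close>

definition weight :: "'a topology \<Rightarrow> 'a set rel" where
  "weight X = (SOME \<kappa>. (\<exists>\<B>. base_of X \<B> \<and> \<kappa> = |\<B>| ) \<and> (\<forall>\<B>. base_of X \<B> \<longrightarrow> \<kappa> \<le>o |\<B>| ))"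

lemma weight:
  shows "\<exists>\<B>. base_of X \<B> \<and> weight X = |\<B>|"
    and "base_of X \<B> \<Longrightarrow> weight X \<le>o |\<B>|"
proof -
  let ?R = "{ |\<B>| | \<B>. base_of X \<B> }"
  have "base_of X {U. openin X U}"
    by (auto simp: base_of_def)
  then have "?R \<noteq> {}" by blast
  moreover have "\<forall>r \<in> ?R. Well_order r" by (auto intro: card_of_Well_order)
  ultimately obtain \<kappa> where "\<kappa> \<in> ?R" "\<forall>r \<in> ?R. \<kappa> \<le>o r"
    using exists_minim_Well_order[of ?R] by blast
  then have "(\<exists>\<B>. base_of X \<B> \<and> \<kappa> = |\<B>| ) \<and> (\<forall>\<B>. base_of X \<B> \<longrightarrow> \<kappa> \<le>o |\<B>| )"
    by blast
  then have "(\<exists>\<B>. base_of X \<B> \<and> weight X = |\<B>| ) \<and>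
      (\<forall>\<B>. base_of X \<B> \<longrightarrow> weight X \<le>o |\<B>| )"
    unfolding weight_def by (rule someI)
  then show "\<exists>\<B>. base_of X \<B> \<and> weight X = |\<B>|"
    and "base_of X \<B> \<Longrightarrow> weight X \<le>o |\<B>|" by blast+
qed


section \<open>Cantor--Bendixson derivatives and rank\<close>

definition derived :: "'a topology \<Rightarrow> 'a set \<Rightarrow> 'a set" where
  "derived X S = S - isolated_points (subtopology X S)"

text \<open>An ordinal is represented by a well-order, and the ordinals below the order type of \<open>r\<close> by the
  elements of \<open>Field r\<close>. Below, \<open>A\<close> is an initial segment of \<open>r\<close>, and \<open>D a\<close> is the derivative whose
  index is the order type of the elements below \<open>a\<close>; \<open>cb_step X r A D\<close> is the derivative whose index
  is the order type of \<open>A\<close>. That ordinal is zero if \<open>A\<close> is empty, a successor if \<open>A\<close> has a greatest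
  element, and a limit otherwise.\<close>

definition cb_step :: "'a topology \<Rightarrow> 'b rel \<Rightarrow> 'b set \<Rightarrow> ('b \<Rightarrow> 'a set) \<Rightarrow> 'a set" where
  "cb_step X r A D =
     (if A = {} then topspace X
      else if \<exists>m \<in> A. \<forall>b \<in> A. (b, m) \<in> r
        then derived X (D (THE m. m \<in> A \<and> (\<forall>b \<in> A. (b, m) \<in> r)))
      else (\<Inter>b \<in> A. D b))"

definition cb_level :: "'a topology \<Rightarrow> 'b rel \<Rightarrow> 'b \<Rightarrow> 'a set" where
  "cb_level X r = wo_rel.worec r (\<lambda>D a. cb_step X r (underS r a) D)"

definition cb_derivative :: "'a topology \<Rightarrow> 'b rel \<Rightarrow> 'a set" where
  "cb_derivative X r = cb_step X r (Field r) (cb_level X r)"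

text \<open>The rank is an ordinal, hence determined up to \<open>=o\<close> only. It has a representative on the type
  of points because a scattered space loses a point at every step; the lemmas \<open>cb_rank\<close> below confirm
  this and show that minimality among well-orders on this type is minimality among all ordinals.\<close>

definition cb_rank :: "'a topology \<Rightarrow> 'a rel" where
  "cb_rank X = (SOME r. Well_order r \<and> cb_derivative X r = {} \<and>
     (\<forall>s :: 'a rel. Well_order s \<and> cb_derivative X s = {} \<longrightarrow> r \<le>o s))"

lemma cb_step_greatest:
  assumes "antisym r" "m \<in> A" "\<forall>b \<in> A. (b, m) \<in> r"
  shows "cb_step X r A D = derived X (D m)"
proof -
  have "(THE m. m \<in> A \<and> (\<forall>b \<in> A. (b, m) \<in> r)) = m"
    using assms by (intro the_equality) (auto dest: antisymD)
  then show ?thesis using assms unfolding cb_step_def by auto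
qed

lemma cb_step_transfer:
  assumes anti: "antisym r" "antisym r'"
    and ord: "\<And>a b. a \<in> A \<Longrightarrow> b \<in> A \<Longrightarrow> (a, b) \<in> r \<longleftrightarrow> (f a, f b) \<in> r'"
    and D: "\<And>a. a \<in> A \<Longrightarrow> D' (f a) = D a"
  shows "cb_step X r' (f ` A) D' = cb_step X r A D"
proof (cases "\<exists>m \<in> A. \<forall>b \<in> A. (b, m) \<in> r")
  case True
  then obtain m where m: "m \<in> A" "\<forall>b \<in> A. (b, m) \<in> r" by blast
  have "cb_step X r A D = derived X (D m)"
    using anti(1) m by (rule cb_step_greatest)
  moreover have "cb_step X r' (f ` A) D' = derived X (D' (f m))"
    using anti(2) m ord by (intro cb_step_greatest) auto
  ultimately show ?thesis using D m by simp
next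
  case False
  then have "\<not> (\<exists>m \<in> f ` A. \<forall>b \<in> f ` A. (b, m) \<in> r')" using ord by auto
  then show ?thesis using False D unfolding cb_step_def by auto
qed

lemma cb_level_unfold:
  fixes X :: "'a topology" and r :: "'b rel"
  assumes "Well_order r"
  shows "cb_level X r a = cb_step X r (underS r a) (cb_level X r)"
proof -
  interpret wo: wo_rel r using assms by (simp add: wo_rel_def)
  have "wo.adm_wo (\<lambda>D a. cb_step X r (underS r a) D)"
    unfolding wo.adm_wo_def
  proof (intro allI impI)
    fix D E :: "'b \<Rightarrow> 'a set" and a
    assume "\<forall>b \<in> underS r a. D b = E b"
    then show "cb_step X r (underS r a) D = cb_step X r (underS r a) E"
      using cb_step_transfer[of r r "underS r a" id D E X] wo.ANTISYM by simp
  qed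
  from wo.worec_fixpoint[OF this] show ?thesis
    unfolding cb_level_def by (metis (no_types, lifting))
qed

lemma cb_level_subset:
  assumes "Well_order r" "b \<in> underS r a"
  shows "cb_level X r a \<subseteq> derived X (cb_level X r b)"
  using assms(2)
proof (induction a arbitrary: b rule: wo_rel.well_order_induct[of r])
  show "wo_rel r" using assms by (simp add: wo_rel_def)
next
  fix a b
  interpret wo: wo_rel r using assms by (simp add: wo_rel_def)
  assume IH: "\<forall>c. c \<noteq> a \<and> (c, a) \<in> r \<longrightarrow>
      (\<forall>b. b \<in> underS r c \<longrightarrow> cb_level X r c \<subseteq> derived X (cb_level X r b))"
    and b: "b \<in> underS r a"
  show "cb_level X r a \<subseteq> derived X (cb_level X r b)"
  proof (cases "\<exists>m \<in> underS r a. \<forall>c \<in> underS r a. (c, m) \<in> r")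
    case True
    then obtain m where m: "m \<in> underS r a" "\<forall>c \<in> underS r a. (c, m) \<in> r" by blast
    have "cb_level X r a = derived X (cb_level X r m)"
      using cb_step_greatest[OF wo.ANTISYM m] cb_level_unfold[OF assms(1)] by metis
    moreover have "cb_level X r m \<subseteq> derived X (cb_level X r b)" if "b \<noteq> m"
      using IH m b that unfolding underS_def by blast
    ultimately show ?thesis unfolding derived_def by blast
  next
    case False
    then obtain c where c: "c \<in> underS r a" "(c, b) \<notin> r" using b by blast
    then have "b \<in> underS r c"
      using b wo.TOTALS wo.REFL unfolding underS_def Field_def refl_on_def by fastforce
    then have "cb_level X r c \<subseteq> derived X (cb_level X r b)"
      using IH c unfolding underS_def by blast
    moreover have "cb_level X r a \<subseteq> cb_level X r c"
      using False c cb_level_unfold[OF assms(1), of X a] unfolding cb_step_def by auto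
    ultimately show ?thesis by blast
  qed
qed

lemma cb_level_transfer:
  assumes W: "Well_order r" "Well_order r'"
    and low: "A \<subseteq> Field r" "\<And>a. a \<in> A \<Longrightarrow> underS r a \<subseteq> A"
      "\<And>a. a \<in> f ` A \<Longrightarrow> underS r' a \<subseteq> f ` A"
    and inj: "inj_on f A"
    and ord: "\<And>a b. a \<in> A \<Longrightarrow> b \<in> A \<Longrightarrow> (a, b) \<in> r \<longleftrightarrow> (f a, f b) \<in> r'"
  shows "\<And>a. a \<in> A \<Longrightarrow> cb_level X r' (f a) = cb_level X r a"
    and "cb_step X r' (f ` A) (cb_level X r') = cb_step X r A (cb_level X r)"
proof -
  have anti: "antisym r" "antisym r'"
    using W by (auto simp: order_on_defs)
  show *: "cb_level X r' (f a) = cb_level X r a" if "a \<in> A" for a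
    using that
  proof (induction a rule: wo_rel.well_order_induct[of r])
    show "wo_rel r" using W by (simp add: wo_rel_def)
  next
    fix a
    assume IH: "\<forall>b. b \<noteq> a \<and> (b, a) \<in> r \<longrightarrow> b \<in> A \<longrightarrow> cb_level X r' (f b) = cb_level X r b"
      and a: "a \<in> A"
    have "underS r' (f a) = f ` underS r a"
    proof
      show "underS r' (f a) \<subseteq> f ` underS r a"
      proof
        fix y assume y: "y \<in> underS r' (f a)"
        then obtain b where "b \<in> A" "y = f b" using low(3) a by blast
        then show "y \<in> f ` underS r a" using y ord a unfolding underS_def by blast
      qed
      show "f ` underS r a \<subseteq> underS r' (f a)"
        using low(2)[OF a] ord a inj unfolding underS_def inj_on_def by blast
    qed
    moreover have "cb_step X r' (f ` underS r a) (cb_level X r') =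
        cb_step X r (underS r a) (cb_level X r)"
    proof (rule cb_step_transfer[OF anti])
      show "(b, c) \<in> r \<longleftrightarrow> (f b, f c) \<in> r'" if "b \<in> underS r a" "c \<in> underS r a" for b c
        using ord low(2)[OF a] that by blast
      show "cb_level X r' (f b) = cb_level X r b" if "b \<in> underS r a" for b
        using IH low(2)[OF a] that unfolding underS_def by blast
    qed
    ultimately show "cb_level X r' (f a) = cb_level X r a"
      using cb_level_unfold W by metis
  qed
  show "cb_step X r' (f ` A) (cb_level X r') = cb_step X r A (cb_level X r)"
    using anti ord * by (rule cb_step_transfer)
qed

lemma cb_derivative_ordIso:
  assumes "r =o r'"
  shows "cb_derivative X r = cb_derivative X r'"
proof -
  from assms obtain f where W: "Well_order r" "Well_order r'" and f: "iso r r' f"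
    unfolding ordIso_def by blast
  from f have bij: "bij_betw f (Field r) (Field r')"
    and ord: "\<And>a b. a \<in> Field r \<Longrightarrow> b \<in> Field r \<Longrightarrow> (a, b) \<in> r \<longleftrightarrow> (f a, f b) \<in> r'"
    unfolding iso_iff2 by blast+
  have im: "f ` Field r = Field r'" using bij by (simp add: bij_betw_def)
  have "cb_step X r' (f ` Field r) (cb_level X r') = cb_step X r (Field r) (cb_level X r)"
    using W bij ord underS_Field[of _ r] underS_Field[of _ r']
    by (intro cb_level_transfer(2)) (auto simp: im bij_betw_def)
  then show ?thesis unfolding cb_derivative_def im by simp
qed

lemma cb_derivative_underS:
  assumes "Well_order r"
  shows "cb_derivative X (Restr r (underS r a)) = cb_level X r a"
proof -
  let ?A = "underS r a" let ?s = "Restr r ?A"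
  interpret wo: wo_rel r using assms by (simp add: wo_rel_def)
  have F: "Field ?s = ?A" using assms wo.underS_ofilter by (simp add: Field_Restr_ofilter)
  have W: "Well_order ?s" using assms by (rule Well_order_Restr)
  have "cb_step X ?s (id ` ?A) (cb_level X ?s) = cb_step X r ?A (cb_level X r)"
  proof (rule cb_level_transfer(2)[OF assms W])
    show "?A \<subseteq> Field r" using underS_Field[of _ r a] by blast
    show "underS r b \<subseteq> ?A" if "b \<in> ?A" for b
      using that wo.TRANS wo.ANTISYM unfolding underS_def trans_def antisym_def by blast
    show "underS ?s b \<subseteq> id ` ?A" for b
      unfolding underS_def by auto
  qed auto
  then have "cb_derivative X ?s = cb_step X r ?A (cb_level X r)"
    unfolding cb_derivative_def F by (simp only: image_id id_apply)
  also have "\<dots> = cb_level X r a"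
    using assms by (rule cb_level_unfold[symmetric])
  finally show ?thesis .
qed

lemma cb_rank_exists:
  fixes X :: "'a topology"
  assumes "scattered X"
  shows "\<exists>r :: 'a rel. Well_order r \<and> cb_derivative X r = {}"
proof -
  define w where "w = |UNIV :: 'a set set|"
  have W: "Well_order w" unfolding w_def by (rule card_of_Well_order)
  have Fw: "Field w = UNIV" unfolding w_def by (simp add: Field_card_of)
  interpret wo: wo_rel w using W by (simp add: wo_rel_def)
  have top: "cb_level X w a \<subseteq> topspace X" for a
  proof (induction a rule: wo.well_order_induct)
    fix a assume IH: "\<forall>b. b \<noteq> a \<and> (b, a) \<in> w \<longrightarrow> cb_level X w b \<subseteq> topspace X"
    show "cb_level X w a \<subseteq> topspace X"
    proof (cases "underS w a = {}")
      case True
      have "cb_level X w a = cb_step X w (underS w a) (cb_level X w)"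
        using W by (rule cb_level_unfold)
      also have "\<dots> = topspace X" unfolding True cb_step_def by (simp only: refl if_True)
      finally show ?thesis by (rule equalityD1)
    next
      case False
      then obtain b where b: "b \<in> underS w a" by blast
      have "cb_level X w a \<subseteq> derived X (cb_level X w b)"
        using W b by (rule cb_level_subset)
      also have "\<dots> \<subseteq> cb_level X w b" unfolding derived_def by (rule Diff_subset)
      also have "\<dots> \<subseteq> topspace X"
        using IH b unfolding underS_def mem_Collect_eq by (elim allE impE)
      finally show ?thesis .
    qed
  qed
  have pick: "\<exists>p. p \<in> cb_level X w a - derived X (cb_level X w a)" if "cb_level X w a \<noteq> {}" for a
  proof -
    have "isolated_points (subtopology X (cb_level X w a)) \<noteq> {}"
      using assms[unfolded scattered_def, rule_format, OF top that] .
    then obtain p where p: "p \<in> isolated_points (subtopology X (cb_level X w a))"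
      by blast
    then have "p \<in> cb_level X w a" unfolding isolated_points_def by simp
    with p show ?thesis unfolding derived_def by blast
  qed
  define f where "f a = (SOME p. p \<in> cb_level X w a - derived X (cb_level X w a))" for a
  have f: "f a \<in> cb_level X w a - derived X (cb_level X w a)" if "cb_level X w a \<noteq> {}" for a
    unfolding f_def using pick[OF that] by (rule someI_ex)
  have neq: "f a \<noteq> f b" if "b \<in> underS w a" "cb_level X w a \<noteq> {}" for a b
  proof -
    have sub: "cb_level X w a \<subseteq> derived X (cb_level X w b)"
      using W that(1) by (rule cb_level_subset)
    have fa: "f a \<in> derived X (cb_level X w b)"
      using sub f[OF that(2), THEN DiffD1] by (rule subsetD)
    then have "cb_level X w b \<noteq> {}" unfolding derived_def by force
    from f[OF this] have "f b \<notin> derived X (cb_level X w b)" by simp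
    with fa show ?thesis by metis
  qed
  have inj: "inj_on f {a. cb_level X w a \<noteq> {}}"
  proof (rule inj_onI, rule ccontr)
    fix a b assume ab: "a \<in> {a. cb_level X w a \<noteq> {}}" "b \<in> {a. cb_level X w a \<noteq> {}}"
      "f a = f b" "a \<noteq> b"
    have "(b, a) \<in> w \<or> (a, b) \<in> w"
      using wo.TOTALS Fw by (metis UNIV_I)
    then show False
    proof
      assume "(b, a) \<in> w"
      with ab(4) have "b \<in> underS w a" by (simp add: underS_def)
      from neq[OF this] ab show False by simp
    next
      assume "(a, b) \<in> w"
      with ab(4) have "a \<in> underS w b" by (simp add: underS_def)
      from neq[OF this] ab show False by simp
    qed
  qed
  have "\<exists>a. cb_level X w a = {}"
  proof (rule ccontr)
    assume "\<not> ?thesis"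
    then have "inj f" using inj by simp
    then have "range (inv f) = Pow UNIV" by (simp only: inj_imp_surj_inv Pow_UNIV)
    then show False by (metis Cantors_theorem)
  qed
  then obtain a where a: "cb_level X w a = {}"
    and least: "\<And>b. b \<in> underS w a \<Longrightarrow> cb_level X w b \<noteq> {}"
  proof -
    assume ex: "\<exists>a. cb_level X w a = {}"
    let ?a = "wo.minim {a. cb_level X w a = {}}"
    have "cb_level X w ?a = {}"
      using wo.minim_in[of "{a. cb_level X w a = {}}"] ex Fw by auto
    moreover have "cb_level X w b \<noteq> {}" if "b \<in> underS w ?a" for b
    proof
      assume "cb_level X w b = {}"
      then have "(?a, b) \<in> w"
        using wo.minim_least[of "{a. cb_level X w a = {}}" b] Fw by auto
      then show False using that wo.ANTISYM unfolding underS_def antisym_def by blast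
    qed
    ultimately show thesis using that by blast
  qed
  define s where "s = Restr w (underS w a)"
  have Ws: "Well_order s" unfolding s_def using W by (rule Well_order_Restr)
  have "Field s \<subseteq> underS w a" unfolding s_def Field_def by auto
  then have "inj_on f (Field s)"
    using least by (intro inj_on_subset[OF inj]) auto
  then have "s =o dir_image s f" "Well_order (dir_image s f)"
    using Ws by (auto intro: dir_image_ordIso Well_order_dir_image)
  moreover have "cb_derivative X s = {}"
    unfolding s_def cb_derivative_underS[OF W] by (rule a)
  ultimately show ?thesis using cb_derivative_ordIso by metis
qed

lemma cb_rank:
  fixes X :: "'a topology"
  assumes "scattered X"
  shows Well_order_cb_rank: "Well_order (cb_rank X)"
    and cb_derivative_cb_rank: "cb_derivative X (cb_rank X) = {}"
    and cb_rank_least: "\<And>s :: 'b rel. Well_order s \<Longrightarrow> cb_derivative X s = {} \<Longrightarrow> cb_rank X \<le>o s"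
proof -
  let ?R = "{r :: 'a rel. Well_order r \<and> cb_derivative X r = {}}"
  have "\<exists>r \<in> ?R. \<forall>s \<in> ?R. r \<le>o s"
    using cb_rank_exists[OF assms] by (intro exists_minim_Well_order) auto
  then have "\<exists>r :: 'a rel. Well_order r \<and> cb_derivative X r = {} \<and>
     (\<forall>s :: 'a rel. Well_order s \<and> cb_derivative X s = {} \<longrightarrow> r \<le>o s)" by blast
  from someI_ex[OF this] have
    W: "Well_order (cb_rank X)" and "cb_derivative X (cb_rank X) = {}" and
    least: "\<And>s :: 'a rel. Well_order s \<Longrightarrow> cb_derivative X s = {} \<Longrightarrow> cb_rank X \<le>o s"
    unfolding cb_rank_def by blast+
  then show "Well_order (cb_rank X)" "cb_derivative X (cb_rank X) = {}" by blast+
  fix s :: "'b rel" assume s: "Well_order s" "cb_derivative X s = {}"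
  show "cb_rank X \<le>o s"
  proof (rule ccontr)
    assume "\<not> ?thesis"
    then have less: "s <o cb_rank X" using W s by (simp add: not_ordLeq_iff_ordLess)
    then obtain a where a: "a \<in> Field (cb_rank X)"
        "s =o Restr (cb_rank X) (underS (cb_rank X) a)"
      using ordLess_iff_ordIso_Restr[of "cb_rank X" s] W s by blast
    let ?t = "Restr (cb_rank X) (underS (cb_rank X) a)"
    have "cb_rank X \<le>o ?t"
      using a s(2) Well_order_Restr[OF W] cb_derivative_ordIso[of s ?t X]
      by (intro least) auto
    then have "cb_rank X \<le>o s" using a(2) ordIso_symmetric ordLeq_ordIso_trans by blast
    then show False using less not_ordLess_ordLeq by blast
  qed
qed


section \<open>Chains and antichains\<close>

definition hantichain :: "'a topology set \<Rightarrow> bool" where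
  "hantichain \<A> \<longleftrightarrow> pairwise (\<lambda>X Y. \<not> X embeds_in Y \<and> \<not> Y embeds_in X) \<A>"

definition strictly_decreasing_chain :: "(nat \<Rightarrow> 'a topology) \<Rightarrow> bool" where
  "strictly_decreasing_chain X \<longleftrightarrow>
     (\<forall>k. X (Suc k) embeds_in X k \<and> \<not> biembeddable (X (Suc k)) (X k))"

end

theory Submission
  imports Defs "HOL-Library.Countable_Set_Type"
begin

text \<open>Both assertions follow once every sequence \<open>Y 0, Y 1, \<dots>\<close> of such spaces has indices \<open>i < j\<close> with
\<open>Y i embeds_in Y j\<close>. All the spaces of a sequence are placed in their topological sum \<open>X\<close>, so that
points of different spaces can be compared and only embeddings between subsets of one space \<open>X\<close> are
needed; \<open>A \<preceq> B\<close> means that \<open>A\<close> is homeomorphic to a subset of \<open>B\<close>.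

Regular P-spaces of weight at most \<open>\<omega>\<^sub>1\<close> behave like separable metrizable zero-dimensional spaces
with \<open>\<omega>\<close> replaced by \<open>\<omega>\<^sub>1\<close>. Open covers refine to partitions into clopen sets, because a clopen set minus
countably many clopen sets is clopen (\<open>disjoint_refinement\<close>). A clopen neighbourhood of a point,
with the point removed, splits into clopen pieces that converge to the point, and an embedding of the
neighbourhood can be built piece by piece along a well-order with countable initial segments. Hence a
clopen neighbourhood \<open>U\<close> of \<open>x\<close> embeds in every neighbourhood of \<open>y\<close> as soon as each clopen
\<open>D \<subseteq> U - {x}\<close> can be embedded arbitrarily close to \<open>y\<close> and away from \<open>y\<close>: \<open>y\<close> absorbs \<open>D\<close>
(\<open>fits_at_point\<close>).

Write \<open>M\<close> for a derivative of \<open>X\<close> of index \<open>\<lambda>\<close> and \<open>D\<close> for the derivative operation, so that \<open>D\<^sup>n M\<close>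
has index \<open>\<lambda> + n\<close>. Call \<open>M\<close> absorbing if each of its points absorbs every open set that misses \<open>M\<close>.
Every derivative of countable index is \<open>D\<^sup>n M\<close> for an absorbing \<open>M\<close>, whose index is
zero or a limit (\<open>derivatives_reduce\<close>). Two facts hold over an absorbing \<open>M\<close>.

First, an open set that misses \<open>D\<^sup>n M\<close> embeds in every neighbourhood of every point of \<open>D\<^sup>2\<^sup>n M\<close>
(\<open>fits_near_derived\<close>): to climb one level one passes from a set to uncountably many disjoint copies
of it, and then from the copies to a point that they converge to, and each passage costs one
derivative. Thus open sets whose ranks are far apart are always comparable.

Second, the open sets that miss \<open>D\<^sup>n M\<close> but meet \<open>M\<close> are, up to embeddings in both directions of the
pieces, disjoint unions of copies of finitely many sets (\<open>decomposition\<close>). A small neighbourhood of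
a point of \<open>D\<^sup>n M\<close> that is outside \<open>D\<^sup>n\<^sup>+\<^sup>1 M\<close> is determined by the answers to two questions about each
of the finitely many sets \<open>N\<close> of the previous level: does the point absorb \<open>N\<close>, and does it absorb
uncountably many disjoint copies of \<open>N\<close>? No finer count matters since countably many absorbed sets
are absorbed together. So each level adds only finitely many new sets.

A sequence of such open sets is therefore a sequence of tuples of cardinals of a fixed finite length,
and Dickson's lemma gives two terms of which the earlier embeds in the later
(\<open>decomposed_not_bad\<close>). With the first fact this excludes bad sequences, in which no term embeds in
a later one, by induction along the derivatives; since the ranks are countable, the empty set is
reached.\<close>

section \<open>Embeddings between subsets of a space\<close>

text \<open>Homeomorphisms of \<open>A\<close> onto its image, stated pointwise in terms of open sets of \<open>X\<close>: embeddings are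
glued below from pieces, and this form needs no subspace topologies.\<close>

definition bicontinuous_on :: "'a topology \<Rightarrow> 'a set \<Rightarrow> ('a \<Rightarrow> 'a) \<Rightarrow> bool" where
  "bicontinuous_on X A f \<longleftrightarrow> inj_on f A \<and>
     (\<forall>x\<in>A. \<forall>V. openin X V \<and> f x \<in> V \<longrightarrow>
        (\<exists>U. openin X U \<and> x \<in> U \<and> (\<forall>a\<in>A. a \<in> U \<longrightarrow> f a \<in> V))) \<and>
     (\<forall>x\<in>A. \<forall>U. openin X U \<and> x \<in> U \<longrightarrow>
        (\<exists>V. openin X V \<and> f x \<in> V \<and> (\<forall>a\<in>A. f a \<in> V \<longrightarrow> a \<in> U)))"

lemma bicontinuous_onD:
  assumes "bicontinuous_on X A f" "x \<in> A"
  shows "openin X V \<Longrightarrow> f x \<in> V \<Longrightarrow> \<exists>U. openin X U \<and> x \<in> U \<and> (\<forall>a\<in>A. a \<in> U \<longrightarrow> f a \<in> V)"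
    and "openin X U \<Longrightarrow> x \<in> U \<Longrightarrow> \<exists>V. openin X V \<and> f x \<in> V \<and> (\<forall>a\<in>A. f a \<in> V \<longrightarrow> a \<in> U)"
  using assms unfolding bicontinuous_on_def by blast+

definition fits :: "'a topology \<Rightarrow> 'a set \<Rightarrow> 'a set \<Rightarrow> bool" where
  "fits X A B \<longleftrightarrow> (\<exists>f. bicontinuous_on X A f \<and> f ` A \<subseteq> B)"

lemma fits_subset: "A \<subseteq> B \<Longrightarrow> fits X A B"
  unfolding fits_def bicontinuous_on_def by (rule exI[of _ "\<lambda>x. x"]) (auto simp: inj_on_def)

lemma fits_trans:
  assumes "fits X A B" "fits X B C"
  shows "fits X A C"
proof -
  obtain f where f: "bicontinuous_on X A f" "f ` A \<subseteq> B"
    using assms(1) unfolding fits_def by blast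
  obtain g where g: "bicontinuous_on X B g" "g ` B \<subseteq> C"
    using assms(2) unfolding fits_def by blast
  have "bicontinuous_on X A (g \<circ> f)"
    unfolding bicontinuous_on_def
  proof (intro conjI ballI allI impI)
    have "inj_on f A" using f(1) unfolding bicontinuous_on_def by blast
    moreover have "inj_on g B" using g(1) unfolding bicontinuous_on_def by blast
    then have "inj_on g (f ` A)" using f(2) by (rule inj_on_subset)
    ultimately show "inj_on (g \<circ> f) A" by (rule comp_inj_on)
  next
    fix x V assume x: "x \<in> A" and V: "openin X V \<and> (g \<circ> f) x \<in> V"
    have fx: "f x \<in> B" using f x by blast
    obtain W where W: "openin X W" "f x \<in> W" "\<forall>b\<in>B. b \<in> W \<longrightarrow> g b \<in> V"
      using bicontinuous_onD(1)[OF g(1) fx] V by auto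
    obtain U where "openin X U" "x \<in> U" "\<forall>a\<in>A. a \<in> U \<longrightarrow> f a \<in> W"
      using bicontinuous_onD(1)[OF f(1) x W(1,2)] by blast
    then show "\<exists>U. openin X U \<and> x \<in> U \<and> (\<forall>a\<in>A. a \<in> U \<longrightarrow> (g \<circ> f) a \<in> V)"
      using W f(2) by (intro exI[of _ U]) auto
  next
    fix x U assume x: "x \<in> A" and U: "openin X U \<and> x \<in> U"
    have fx: "f x \<in> B" using f x by blast
    obtain W where W: "openin X W" "f x \<in> W" "\<forall>a\<in>A. f a \<in> W \<longrightarrow> a \<in> U"
      using bicontinuous_onD(2)[OF f(1) x] U by auto
    obtain V where "openin X V" "g (f x) \<in> V" "\<forall>b\<in>B. g b \<in> V \<longrightarrow> b \<in> W"
      using bicontinuous_onD(2)[OF g(1) fx W(1,2)] by blast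
    then show "\<exists>V. openin X V \<and> (g \<circ> f) x \<in> V \<and> (\<forall>a\<in>A. (g \<circ> f) a \<in> V \<longrightarrow> a \<in> U)"
      using W f(2) by (intro exI[of _ V]) auto
  qed
  moreover have "(g \<circ> f) ` A \<subseteq> C" using f g by auto
  ultimately show ?thesis unfolding fits_def by blast
qed

lemma fits_mono: "fits X A B \<Longrightarrow> A' \<subseteq> A \<Longrightarrow> B \<subseteq> B' \<Longrightarrow> fits X A' B'"
  by (meson fits_subset fits_trans)

text \<open>Pieces that are open and disjoint on both sides can be embedded independently. The individual images
are recorded because \<open>one_point_extension\<close> depends on where each piece goes.\<close>

lemma fits_sum_map:
  assumes P: "disjoint_family_on P I" "\<And>i. i \<in> I \<Longrightarrow> openin X (P i)"
    and Q: "disjoint_family_on Q I" "\<And>i. i \<in> I \<Longrightarrow> openin X (Q i)"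
    and fit: "\<And>i. i \<in> I \<Longrightarrow> fits X (P i) (Q i)"
  shows "\<exists>f. bicontinuous_on X (\<Union>i\<in>I. P i) f \<and> (\<forall>i\<in>I. f ` P i \<subseteq> Q i)"
proof -
  obtain F where F: "\<And>i. i \<in> I \<Longrightarrow> bicontinuous_on X (P i) (F i)" "\<And>i. i \<in> I \<Longrightarrow> F i ` P i \<subseteq> Q i"
    using fit unfolding fits_def by metis
  define f where "f x = F (THE i. i \<in> I \<and> x \<in> P i) x" for x
  have uP: "i = j" if "i \<in> I" "j \<in> I" "x \<in> P i" "x \<in> P j" for i j x
    using that P(1) unfolding disjoint_family_on_def by blast
  have uQ: "i = j" if "i \<in> I" "j \<in> I" "x \<in> Q i" "x \<in> Q j" for i j x
    using that Q(1) unfolding disjoint_family_on_def by blast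
  have f: "f x = F i x" if "i \<in> I" "x \<in> P i" for i x
  proof -
    have "(THE i. i \<in> I \<and> x \<in> P i) = i" using that uP by blast
    then show ?thesis unfolding f_def by simp
  qed
  have im: "f ` P i \<subseteq> Q i" if "i \<in> I" for i
    using F(2)[OF that] f[OF that] by auto
  have "bicontinuous_on X (\<Union>i\<in>I. P i) f"
    unfolding bicontinuous_on_def
  proof (intro conjI ballI allI impI)
    show "inj_on f (\<Union>i\<in>I. P i)"
    proof (rule inj_onI)
      fix x y assume "x \<in> (\<Union>i\<in>I. P i)" "y \<in> (\<Union>i\<in>I. P i)" and eq: "f x = f y"
      then obtain i j where ij: "i \<in> I" "x \<in> P i" "j \<in> I" "y \<in> P j" by blast
      then have "i = j" using im eq uQ by (metis image_subset_iff)
      then show "x = y"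
        using F(1)[OF ij(1)] ij eq f unfolding bicontinuous_on_def inj_on_def by metis
    qed
  next
    fix x V assume "x \<in> (\<Union>i\<in>I. P i)" and V: "openin X V \<and> f x \<in> V"
    then obtain i where i: "i \<in> I" "x \<in> P i" by blast
    then obtain U where U: "openin X U" "x \<in> U" "\<forall>a\<in>P i. a \<in> U \<longrightarrow> F i a \<in> V"
      using bicontinuous_onD(1)[OF F(1)] V f by metis
    then show "\<exists>U. openin X U \<and> x \<in> U \<and> (\<forall>a\<in>\<Union>i\<in>I. P i. a \<in> U \<longrightarrow> f a \<in> V)"
      using i P(2) f by (intro exI[of _ "U \<inter> P i"]) auto
  next
    fix x U assume "x \<in> (\<Union>i\<in>I. P i)" and U: "openin X U \<and> x \<in> U"
    then obtain i where i: "i \<in> I" "x \<in> P i" by blast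
    then obtain V where V: "openin X V" "f x \<in> V" "\<forall>a\<in>P i. F i a \<in> V \<longrightarrow> a \<in> U"
      using bicontinuous_onD(2)[OF F(1)] U f by metis
    have "\<forall>a\<in>\<Union>i\<in>I. P i. f a \<in> V \<inter> Q i \<longrightarrow> a \<in> U"
    proof (intro ballI impI)
      fix a assume "a \<in> (\<Union>i\<in>I. P i)" and a: "f a \<in> V \<inter> Q i"
      then obtain j where j: "j \<in> I" "a \<in> P j" by blast
      then have "f a \<in> Q j" using im by blast
      then have "j = i" using uQ a i j by blast
      then show "a \<in> U" using V(3) j a f by auto
    qed
    moreover have "f x \<in> Q i" using im i by blast
    ultimately show "\<exists>V. openin X V \<and> f x \<in> V \<and> (\<forall>a\<in>\<Union>i\<in>I. P i. f a \<in> V \<longrightarrow> a \<in> U)"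
      using V Q(2) i by (intro exI[of _ "V \<inter> Q i"]) auto
  qed
  with im show ?thesis by blast
qed

lemma fits_sum:
  assumes "disjoint_family_on P I" "\<And>i. i \<in> I \<Longrightarrow> openin X (P i)"
    and "disjoint_family_on Q I" "\<And>i. i \<in> I \<Longrightarrow> openin X (Q i)"
    and "\<And>i. i \<in> I \<Longrightarrow> fits X (P i) (Q i)"
  shows "fits X (\<Union>i\<in>I. P i) (\<Union>i\<in>I. Q i)"
proof -
  obtain f where "bicontinuous_on X (\<Union>i\<in>I. P i) f" "\<forall>i\<in>I. f ` P i \<subseteq> Q i"
    using fits_sum_map[OF assms] by blast
  then show ?thesis unfolding fits_def by blast
qed

lemma bicontinuous_on_imp_homeomorphic:
  assumes f: "bicontinuous_on X A f" and A: "A \<subseteq> topspace X" and fA: "f ` A \<subseteq> topspace X"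
  shows "subtopology X A homeomorphic_space subtopology X (f ` A)"
proof -
  let ?S = "subtopology X A" and ?T = "subtopology X (f ` A)"
  have tS: "topspace ?S = A" and tT: "topspace ?T = f ` A" using A fA by auto
  have "continuous_map ?S ?T f"
    unfolding continuous_map_in_subtopology
  proof (intro conjI)
    show "continuous_map ?S X f"
      unfolding continuous_map_def tS
    proof (intro conjI allI impI)
      show "f \<in> A \<rightarrow> topspace X" using fA by auto
      fix V assume V: "openin X V"
      show "openin ?S {x \<in> A. f x \<in> V}"
      proof (subst openin_subopen, intro ballI)
        fix x assume x: "x \<in> {x \<in> A. f x \<in> V}"
        then obtain U where "openin X U" "x \<in> U" "\<forall>a\<in>A. a \<in> U \<longrightarrow> f a \<in> V"
          using bicontinuous_onD(1)[OF f _ V] by blast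
        then show "\<exists>T. openin ?S T \<and> x \<in> T \<and> T \<subseteq> {x \<in> A. f x \<in> V}"
          using x by (intro exI[of _ "A \<inter> U"]) (auto simp: openin_subtopology_Int2)
      qed
    qed
  qed (use tS in auto)
  moreover have "open_map ?S ?T f"
    unfolding open_map_def
  proof (intro allI impI)
    fix W assume W: "openin ?S W"
    then obtain U where U: "openin X U" "W = U \<inter> A" unfolding openin_subtopology by blast
    show "openin ?T (f ` W)"
    proof (subst openin_subopen, intro ballI)
      fix y assume "y \<in> f ` W"
      then obtain x where x: "x \<in> A" "x \<in> U" "y = f x" using U by blast
      then obtain V where V: "openin X V" "f x \<in> V" "\<forall>a\<in>A. f a \<in> V \<longrightarrow> a \<in> U"
        using bicontinuous_onD(2)[OF f x(1) U(1)] by blast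
      then show "\<exists>T. openin ?T T \<and> y \<in> T \<and> T \<subseteq> f ` W"
        using x U by (intro exI[of _ "f ` A \<inter> V"]) (auto simp: openin_subtopology_Int2)
    qed
  qed
  moreover have "inj_on f A" using f unfolding bicontinuous_on_def by blast
  ultimately have "homeomorphic_map ?S ?T f"
    using tS tT by (simp add: bijective_open_imp_homeomorphic_map)
  then show ?thesis by (rule homeomorphic_map_imp_homeomorphic_space)
qed

section \<open>P-spaces of weight at most \<open>\<omega>\<^sub>1\<close>\<close>

text \<open>Regularity enters only through clopen neighbourhoods, so these are assumed directly; in this form the
class is easily seen to be closed under countable sums.\<close>

locale omega1_P_space =
  fixes X :: "'a topology" and \<B> :: "'a set set"
  assumes t1: "t1_space X"
    and P_space: "P_space X"
    and clopen_nbhd: "openin X U \<Longrightarrow> x \<in> U \<Longrightarrow> \<exists>K. openin X K \<and> closedin X K \<and> x \<in> K \<and> K \<subseteq> U"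
    and base: "base_of X \<B>"
    and card_base: "|\<B>| \<le>o cardSuc natLeq"
begin

abbreviation fits_in (infix "\<preceq>" 50) where "A \<preceq> B \<equiv> fits X A B"

lemma openin_countable_INT:
  assumes "countable I" "\<And>i. i \<in> I \<Longrightarrow> openin X (U i)"
  shows "openin X (topspace X \<inter> (\<Inter>i\<in>I. U i))"
proof -
  have "(countable intersection_of openin X) (topspace X \<inter> \<Inter>(U ` I))"
  proof (cases "I = {}")
    case True
    then show ?thesis by (simp add: countable_intersection_of_inc)
  next
    case False
    have "topspace X \<inter> \<Inter>(U ` I) = \<Inter>(U ` I)"
      using False assms(2) openin_subset by fastforce
    then show ?thesis
      using assms unfolding intersection_of_def by (intro exI[of _ "U ` I"]) auto
  qed
  then have "gdelta_in X (topspace X \<inter> (\<Inter>i\<in>I. U i))"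
    by (simp add: gdelta_in_alt)
  then show ?thesis using P_space unfolding P_space_def by blast
qed

text \<open>The dual of the P-space property. It makes countable unions of clopen sets clopen, which is what
replaces finite unions in classical arguments.\<close>

lemma closedin_countable_UN:
  assumes "countable I" "\<And>i. i \<in> I \<Longrightarrow> closedin X (C i)"
  shows "closedin X (\<Union>i\<in>I. C i)"
proof -
  have "openin X (topspace X \<inter> (\<Inter>i\<in>I. topspace X - C i))"
    using assms by (intro openin_countable_INT) auto
  moreover have "topspace X \<inter> (\<Inter>i\<in>I. topspace X - C i) = topspace X - (\<Union>i\<in>I. C i)"
    by auto
  moreover have "(\<Union>i\<in>I. C i) \<subseteq> topspace X" using assms(2) closedin_subset by blast
  ultimately show ?thesis by (simp add: closedin_def)
qed

lemma closedin_countable: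
  assumes "countable S" "S \<subseteq> topspace X"
  shows "closedin X S"
proof -
  have "closedin X (\<Union>x\<in>S. {x})"
    using assms t1 by (intro closedin_countable_UN) (auto simp: t1_space_closedin_singleton)
  then show ?thesis by simp
qed

text \<open>A cardinal well-order of the base. Since the base has at most \<open>\<omega>\<^sub>1\<close> elements, every initial segment is
countable, so constructions along it remain within reach of the P-space property.\<close>

definition before :: "('a set \<times> 'a set) set" where
  "before = |\<B>| - Id"

lemma wf_before: "wf before"
  using card_of_well_order_on[of \<B>] unfolding before_def well_order_on_def by blast

lemma before_total: "B \<in> \<B> \<Longrightarrow> C \<in> \<B> \<Longrightarrow> B \<noteq> C \<Longrightarrow> (B, C) \<in> before \<or> (C, B) \<in> before"
  using card_of_well_order_on[of \<B>]
  unfolding before_def well_order_on_def linear_order_on_def total_on_def by blast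

lemma countable_before: "countable {C. (C, B) \<in> before}"
proof (cases "B \<in> \<B>")
  case True
  let ?S = "underS (card_of \<B>) B"
  have eq: "{C. (C, B) \<in> before} = ?S" unfolding before_def underS_def by auto
  have "|?S| <o |\<B>|"
    using True card_of_underS[OF card_of_Card_order, of B \<B>] by (simp add: Field_card_of)
  then have "|?S| <o cardSuc natLeq"
    using card_base ordLess_ordLeq_trans by blast
  then have "|?S| \<le>o natLeq"
    using cardSuc_ordLeq_ordLess[OF natLeq_Card_order card_of_Card_order] by blast
  then show ?thesis unfolding eq countable_card_le_natLeq .
next
  case False
  then have "{C. (C, B) \<in> before} = {}"
    using card_of_well_order_on[of \<B>] FieldI2[of _ B "card_of \<B>"] unfolding before_def
    by (auto simp: Field_card_of)
  then show ?thesis by simp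
qed

text \<open>Disjoint nonempty open sets contain distinct base elements, so there are at most \<open>\<omega>\<^sub>1\<close> of them, and
every uncountable family is large enough to receive them. This is why \<open>uncountable\<close> is the only
infinite size above countable that has to be distinguished.\<close>

lemma disjoint_open_inj_into_uncountable:
  assumes P: "disjoint \<P>" "\<And>P. P \<in> \<P> \<Longrightarrow> openin X P \<and> P \<noteq> {}" and Q: "uncountable \<Q>"
  shows "\<exists>\<phi>. inj_on \<phi> \<P> \<and> \<phi> ` \<P> \<subseteq> \<Q>"
proof -
  have "\<exists>B\<in>\<B>. B \<noteq> {} \<and> B \<subseteq> P" if "P \<in> \<P>" for P
    using P(2)[OF that] base unfolding base_of_def by (metis all_not_in_conv)
  then obtain b where b: "\<And>P. P \<in> \<P> \<Longrightarrow> b P \<in> \<B> \<and> b P \<noteq> {} \<and> b P \<subseteq> P" by metis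
  have "inj_on b \<P>"
    using b P(1) unfolding inj_on_def disjoint_def by (metis Int_greatest subset_empty)
  then have "|\<P>| \<le>o |\<B>|" using b unfolding card_of_ordLeq[symmetric] by blast
  then have 1: "|\<P>| \<le>o cardSuc natLeq" using card_base ordLeq_transitive by blast
  have "\<not> |\<Q>| \<le>o natLeq"
    using Q unfolding countable_card_le_natLeq .
  then have "natLeq <o |\<Q>|" using natLeq_Card_order card_of_Card_order
    by (metis card_order_on_well_order_on not_ordLeq_iff_ordLess)
  then have "cardSuc natLeq \<le>o |\<Q>|"
    using cardSuc_least natLeq_Card_order card_of_Card_order by blast
  with 1 have "|\<P>| \<le>o |\<Q>|" using ordLeq_transitive by blast
  then show ?thesis unfolding card_of_ordLeq[symmetric] by blast
qed

text \<open>List the base elements that lie in a clopen subset of a covering set, and remove from each of those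
clopen sets all the earlier ones. Only countably many are earlier, so what remains is clopen.\<close>

lemma disjoint_refinement:
  assumes \<C>: "\<And>C. C \<in> \<C> \<Longrightarrow> openin X C"
  shows "\<exists>\<O>. disjoint \<O> \<and> \<Union>\<O> = \<Union>\<C> \<and> 
     (\<forall>Q\<in>\<O>. openin X Q \<and> closedin X Q \<and> Q \<noteq> {} \<and> (\<exists>C\<in>\<C>. Q \<subseteq> C))"
proof -
  define inside where "inside B K \<longleftrightarrow> openin X K \<and> closedin X K \<and> B \<subseteq> K \<and> (\<exists>C\<in>\<C>. K \<subseteq> C)" for B K
  define \<B>' where "\<B>' = {B \<in> \<B>. \<exists>K. inside B K}"
  have "\<forall>B\<in>\<B>'. \<exists>K. inside B K" unfolding \<B>'_def by blast
  from bchoice[OF this] obtain K where K: "\<And>B. B \<in> \<B>' \<Longrightarrow> inside B (K B)" by blast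
  \<comment> \<open>The points that are first covered at stage \<open>B\<close>.\<close>
  define Q where "Q B = K B - (\<Union>C\<in>{C. (C, B) \<in> before} \<inter> \<B>'. K C)" for B
  have openQ: "openin X (Q B)" if "B \<in> \<B>'" for B
    unfolding Q_def
    using K that countable_before[of B] unfolding inside_def
    by (intro openin_diff closedin_countable_UN) auto
  have closedQ: "closedin X (Q B)" if "B \<in> \<B>'" for B
    unfolding Q_def
    using K that unfolding inside_def by (intro closedin_diff openin_Union) auto
  have disjQ: "Q B \<inter> Q C = {}" if "B \<in> \<B>'" "C \<in> \<B>'" "B \<noteq> C" for B C
  proof -
    have "(B, C) \<in> before \<or> (C, B) \<in> before" using that before_total unfolding \<B>'_def by blast
    then show ?thesis using that unfolding Q_def by blast
  qed
  have cover: "\<exists>B\<in>\<B>'. x \<in> Q B" if "x \<in> \<Union>\<C>" for x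
  proof -
    from that obtain C where C: "C \<in> \<C>" "x \<in> C" by blast
    obtain L where L: "openin X L" "closedin X L" "x \<in> L" "L \<subseteq> C"
      using clopen_nbhd[OF \<C>[OF C(1)] C(2)] by blast
    obtain B where "B \<in> \<B>" "x \<in> B" "B \<subseteq> L"
      using base L unfolding base_of_def by metis
    then have "B \<in> \<B>'" "x \<in> K B" 
      using L C K[of B] unfolding \<B>'_def inside_def by blast+
    then have "B \<in> {B \<in> \<B>'. x \<in> K B}" by blast
    then have "\<exists>B0\<in>{B \<in> \<B>'. x \<in> K B}. \<forall>C. (C, B0) \<in> before \<longrightarrow> C \<notin> {B \<in> \<B>'. x \<in> K B}"
      by (rule wf_before[unfolded wf_eq_minimal, rule_format])
    then show ?thesis unfolding Q_def by blast
  qed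
  have sub: "\<exists>C\<in>\<C>. Q B \<subseteq> C" if "B \<in> \<B>'" for B
    using K[OF that] unfolding inside_def Q_def by blast
  let ?O = "Q ` \<B>' - {{}}"
  have "disjoint ?O"
  proof (rule disjointI)
    fix S T assume "S \<in> ?O" "T \<in> ?O" "S \<noteq> T"
    then show "S \<inter> T = {}" using disjQ by (metis DiffD1 imageE)
  qed
  moreover have "\<Union>?O = \<Union>\<C>"
  proof (intro equalityI subsetI)
    fix x assume "x \<in> \<Union>?O"
    then show "x \<in> \<Union>\<C>" using sub by blast
  next
    fix x assume "x \<in> \<Union>\<C>"
    then obtain B where "B \<in> \<B>'" "x \<in> Q B" using cover by blast
    then show "x \<in> \<Union>?O" by blast
  qed
  moreover have "\<forall>S\<in>?O. openin X S \<and> closedin X S \<and> S \<noteq> {} \<and> (\<exists>C\<in>\<C>. S \<subseteq> C)"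
    using openQ closedQ sub by auto
  ultimately show ?thesis by (intro exI[of _ ?O] conjI)
qed

end

section \<open>The derivative of a set\<close>

lemma derived_iff:
  assumes "S \<subseteq> topspace X"
  shows "x \<in> derived X S \<longleftrightarrow> x \<in> S \<and> (\<forall>U. openin X U \<and> x \<in> U \<longrightarrow> (\<exists>z\<in>S. z \<in> U \<and> z \<noteq> x))"
proof -
  have "openin (subtopology X S) {x} \<longleftrightarrow> (\<exists>U. openin X U \<and> x \<in> U \<and> (\<forall>z\<in>S. z \<in> U \<longrightarrow> z = x))" if "x \<in> S"
  proof -
    have "openin (subtopology X S) {x} \<longleftrightarrow> (\<exists>U. openin X U \<and> {x} = U \<inter> S)"
      by (simp add: openin_subtopology)
    also have "\<dots> \<longleftrightarrow> (\<exists>U. openin X U \<and> x \<in> U \<and> (\<forall>z\<in>S. z \<in> U \<longrightarrow> z = x))"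
      using that by (intro ex_cong1) blast
    finally show ?thesis .
  qed
  then show ?thesis
    using assms unfolding derived_def isolated_points_def by auto
qed

lemma derived_subset: "derived X S \<subseteq> S"
  unfolding derived_def by blast

lemma derived_mono:
  assumes "S \<subseteq> T" "T \<subseteq> topspace X"
  shows "derived X S \<subseteq> derived X T"
proof
  have S: "S \<subseteq> topspace X" using assms by blast
  fix x assume "x \<in> derived X S"
  then show "x \<in> derived X T" using assms(1) unfolding derived_iff[OF S] derived_iff[OF assms(2)] by blast
qed

lemma closedin_derived:
  assumes "closedin X S"
  shows "closedin X (derived X S)"
proof -
  have S: "S \<subseteq> topspace X" using assms by (rule closedin_subset)
  have "openin X (topspace X - derived X S)"
  proof (subst openin_subopen, intro ballI)
    fix x assume x: "x \<in> topspace X - derived X S"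
    show "\<exists>T. openin X T \<and> x \<in> T \<and> T \<subseteq> topspace X - derived X S"
    proof (cases "x \<in> S")
      case True
      have "x \<notin> derived X S" using x by blast
      with True obtain U where U: "openin X U" "x \<in> U" "\<forall>z\<in>S. z \<in> U \<longrightarrow> z = x"
        unfolding derived_iff[OF S] by blast
      then have "U \<inter> derived X S = {}" using x derived_subset[of X S] by blast
      then show ?thesis using U openin_subset by (intro exI[of _ U]) blast
    next
      case False
      then show ?thesis
        using x assms derived_subset[of X S] by (intro exI[of _ "topspace X - S"]) auto
    qed
  qed
  then show ?thesis using S derived_subset[of X S] by (simp add: closedin_def)
qed

section \<open>Sets absorbed by a point\<close>

context omega1_P_space
begin

text \<open>Copies of \<open>P\<close> exist in every neighbourhood of \<open>y\<close>, and each can be kept away from \<open>y\<close> by a further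
neighbourhood. A copy that merely accumulates at \<open>y\<close> would block the repeated insertion of pieces around
\<open>y\<close>.\<close>

definition absorbs :: "'a \<Rightarrow> 'a set \<Rightarrow> bool" where
  "absorbs y P \<longleftrightarrow> (\<forall>V. openin X V \<and> y \<in> V \<longrightarrow>
     (\<exists>W. openin X W \<and> closedin X W \<and> y \<in> W \<and> P \<preceq> V - W))"

lemma absorbsI:
  assumes "\<And>V. openin X V \<Longrightarrow> y \<in> V \<Longrightarrow> \<exists>W. openin X W \<and> y \<in> W \<and> P \<preceq> V - W"
  shows "absorbs y P"
  unfolding absorbs_def
proof (intro allI impI)
  fix V assume "openin X V \<and> y \<in> V"
  then obtain W where W: "openin X W" "y \<in> W" "P \<preceq> V - W" using assms by blast
  obtain K where K: "openin X K" "closedin X K" "y \<in> K" "K \<subseteq> W" using clopen_nbhd W by blast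
  then have "P \<preceq> V - K" using fits_mono[OF W(3), of P "V - K"] by blast
  then show "\<exists>W. openin X W \<and> closedin X W \<and> y \<in> W \<and> P \<preceq> V - W" using K by blast
qed

lemma absorbs_mono: "absorbs y P' \<Longrightarrow> P \<preceq> P' \<Longrightarrow> absorbs y P"
  unfolding absorbs_def by (meson fits_trans)

lemma absorbs_imp_fits:
  assumes "absorbs y P" "openin X V" "y \<in> V"
  shows "P \<preceq> V"
proof -
  obtain W where "P \<preceq> V - W" using assms unfolding absorbs_def by blast
  then show ?thesis by (rule fits_mono) auto
qed

text \<open>Disjoint copies of the \<open>P i\<close> are placed around \<open>y\<close> by recursion: the copy of \<open>P i\<close> goes into the part of
\<open>N i\<close> left over by neighbourhoods that earlier copies avoid. That part is a neighbourhood of \<open>y\<close>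
because only countably many steps precede \<open>i\<close>.\<close>

lemma absorbing_recursion:
  fixes R :: "('i \<times> 'i) set"
  assumes R: "wf R" "\<And>i. i \<in> I \<Longrightarrow> countable {j\<in>I. (j, i) \<in> R}"
      "\<And>i j. i \<in> I \<Longrightarrow> j \<in> I \<Longrightarrow> i \<noteq> j \<Longrightarrow> (i, j) \<in> R \<or> (j, i) \<in> R"
    and y: "y \<in> topspace X"
    and abs: "\<And>i. i \<in> I \<Longrightarrow> absorbs y (P i)"
    and N: "\<And>i. i \<in> I \<Longrightarrow> openin X (N i) \<and> y \<in> N i"
  shows "\<exists>E. disjoint_family_on E I \<and>
     (\<forall>i\<in>I. openin X (E i) \<and> P i \<preceq> E i \<and> E i \<subseteq> N i \<and> (\<exists>W. openin X W \<and> y \<in> W \<and> W \<inter> E i = {}))"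
proof -
  define M where "M f i = N i \<inter> (topspace X \<inter> (\<Inter>j\<in>{j\<in>I. (j, i) \<in> R}. f j))" for f :: "'i \<Rightarrow> 'a set" and i
  have "\<exists>W. \<forall>i. i \<in> I \<longrightarrow> openin X (W i) \<and> closedin X (W i) \<and> y \<in> W i \<and> P i \<preceq> M W i - W i"
  proof (rule dependent_wf_choice[OF R(1)])
    fix f g :: "'i \<Rightarrow> 'a set" and i r
    assume "\<And>z. (z, i) \<in> R \<Longrightarrow> f z = g z"
    then have "M f i = M g i" unfolding M_def by auto
    then show "(i \<in> I \<longrightarrow> openin X r \<and> closedin X r \<and> y \<in> r \<and> P i \<preceq> M f i - r) =
        (i \<in> I \<longrightarrow> openin X r \<and> closedin X r \<and> y \<in> r \<and> P i \<preceq> M g i - r)" by simp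
  next
    fix i f
    assume IH: "\<And>j. (j, i) \<in> R \<Longrightarrow>
      j \<in> I \<longrightarrow> openin X (f j) \<and> closedin X (f j) \<and> y \<in> f j \<and> P j \<preceq> M f j - f j"
    show "\<exists>r. i \<in> I \<longrightarrow> openin X r \<and> closedin X r \<and> y \<in> r \<and> P i \<preceq> M f i - r"
    proof (cases "i \<in> I")
      case True
      have "openin X (M f i)"
        unfolding M_def using True IH N R(2)
        by (intro openin_Int[OF _ openin_countable_INT]) auto
      moreover have "y \<in> M f i" unfolding M_def using True IH N y by auto
      ultimately show ?thesis using abs[OF True] unfolding absorbs_def by blast
    qed simp
  qed
  then obtain W where W: "\<And>i. i \<in> I \<Longrightarrow> openin X (W i) \<and> closedin X (W i) \<and> y \<in> W i \<and> P i \<preceq> M W i - W i"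
    by blast
  have openM: "openin X (M W i)" if "i \<in> I" for i
    unfolding M_def using that W N R(2) by (intro openin_Int[OF _ openin_countable_INT]) auto
  have "disjoint_family_on (\<lambda>i. M W i - W i) I"
    unfolding disjoint_family_on_def
  proof (intro ballI impI)
    fix i j assume "i \<in> I" "j \<in> I" "i \<noteq> j"
    then show "(M W i - W i) \<inter> (M W j - W j) = {}" using R(3)[of i j] unfolding M_def by blast
  qed
  moreover have "openin X (M W i - W i)" if "i \<in> I" for i
    using that openM W by (simp add: openin_diff)
  moreover have "M W i - W i \<subseteq> N i" for i
    unfolding M_def by blast
  moreover have "\<exists>K. openin X K \<and> y \<in> K \<and> K \<inter> (M W i - W i) = {}" if "i \<in> I" for i
    using W[OF that] by (intro exI[of _ "W i"]) simp
  ultimately show ?thesis using W by (intro exI[of _ "\<lambda>i. M W i - W i"] conjI ballI) simp_all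
qed

text \<open>Countably many neighbourhoods of \<open>y\<close>, each avoiding one copy, intersect in a neighbourhood that avoids
all of them.\<close>

lemma absorbs_countable_UN:
  assumes I: "countable I" and P: "disjoint_family_on P I" "\<And>i. i \<in> I \<Longrightarrow> openin X (P i)"
    and y: "y \<in> topspace X" and abs: "\<And>i. i \<in> I \<Longrightarrow> absorbs y (P i)"
  shows "absorbs y (\<Union>i\<in>I. P i)"
proof (rule absorbsI)
  fix V assume V: "openin X V" "y \<in> V"
  let ?R = "inv_image less_than (to_nat_on I)"
  have "\<exists>E. disjoint_family_on E I \<and>
     (\<forall>i\<in>I. openin X (E i) \<and> P i \<preceq> E i \<and> E i \<subseteq> V \<and> (\<exists>W. openin X W \<and> y \<in> W \<and> W \<inter> E i = {}))"
  proof (rule absorbing_recursion[of ?R])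
    show "(i, j) \<in> ?R \<or> (j, i) \<in> ?R" if "i \<in> I" "j \<in> I" "i \<noteq> j" for i j
    proof -
      have "to_nat_on I i \<noteq> to_nat_on I j"
        using that inj_on_to_nat_on[OF I] by (meson inj_onD)
      then show ?thesis by (auto simp: inv_image_def)
    qed
    show "countable {j \<in> I. (j, i) \<in> ?R}" for i using I by (rule countable_subset[rotated]) blast
  qed (use abs V y in auto)
  then obtain E where E: "disjoint_family_on E I" "\<And>i. i \<in> I \<Longrightarrow> openin X (E i) \<and> P i \<preceq> E i \<and> E i \<subseteq> V"
      "\<forall>i\<in>I. \<exists>W. openin X W \<and> y \<in> W \<and> W \<inter> E i = {}" by blast
  from bchoice[OF E(3)] obtain W where W: "\<And>i. i \<in> I \<Longrightarrow> openin X (W i) \<and> y \<in> W i \<and> W i \<inter> E i = {}"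
    by blast
  have "(\<Union>i\<in>I. P i) \<preceq> (\<Union>i\<in>I. E i)" using P E by (intro fits_sum) auto
  moreover have "(\<Union>i\<in>I. E i) \<subseteq> V - (topspace X \<inter> (\<Inter>i\<in>I. W i))"
  proof
    fix z assume "z \<in> (\<Union>i\<in>I. E i)"
    then obtain i where "i \<in> I" "z \<in> E i" by (rule UN_E)
    moreover from this have "z \<notin> W i" "z \<in> V" using E(2) W by (metis IntI empty_iff, metis subsetD)
    ultimately show "z \<in> V - (topspace X \<inter> (\<Inter>i\<in>I. W i))" by simp blast
  qed
  ultimately have "(\<Union>i\<in>I. P i) \<preceq> V - (topspace X \<inter> (\<Inter>i\<in>I. W i))"
    using fits_mono[OF _ subset_refl] by metis
  moreover have "openin X (topspace X \<inter> (\<Inter>i\<in>I. W i))" using I W by (intro openin_countable_INT) auto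
  moreover have "y \<in> topspace X \<inter> (\<Inter>i\<in>I. W i)" using y W by auto
  ultimately show "\<exists>W. openin X W \<and> y \<in> W \<and> (\<Union>i\<in>I. P i) \<preceq> V - W" by blast
qed

text \<open>If the pieces converge to \<open>x\<close> and their images converge to \<open>y\<close>, with all but countably many inside any
given neighbourhood, then mapping \<open>x\<close> to \<open>y\<close> keeps the map bicontinuous: the countably many exceptions
are avoided by one neighbourhood. The assumptions are symmetric in the two sides, and so are the two
halves of the argument at the added point.\<close>

lemma one_point_extension:
  assumes f: "bicontinuous_on X (\<Union>i\<in>I. D i) f" "\<And>i. i \<in> I \<Longrightarrow> f ` D i \<subseteq> E i"
    and DE: "\<And>i. i \<in> I \<Longrightarrow> openin X (D i) \<and> openin X (E i)" "disjoint_family_on E I"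
    and x: "\<And>i. i \<in> I \<Longrightarrow> \<exists>N. openin X N \<and> x \<in> N \<and> N \<inter> D i = {}"
      "\<And>N. openin X N \<Longrightarrow> x \<in> N \<Longrightarrow> countable {i\<in>I. \<not> D i \<subseteq> N}"
    and y: "\<And>i. i \<in> I \<Longrightarrow> \<exists>N. openin X N \<and> y \<in> N \<and> N \<inter> E i = {}"
      "\<And>N. openin X N \<Longrightarrow> y \<in> N \<Longrightarrow> countable {i\<in>I. \<not> E i \<subseteq> N}"
    and xy: "x \<in> topspace X" "y \<in> topspace X"
  shows "insert x (\<Union>i\<in>I. D i) \<preceq> insert y (\<Union>i\<in>I. E i)"
proof -
  let ?A = "\<Union>i\<in>I. D i"
  define g where "g = f(x := y)"
  have xA: "x \<notin> ?A" using x(1) by blast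
  have yE: "y \<notin> E i" if "i \<in> I" for i using y(1)[OF that] by blast
  have g: "g x = y" "\<And>a. a \<in> ?A \<Longrightarrow> g a = f a" using xA unfolding g_def by auto
  have gE: "g a \<in> E i" if "i \<in> I" "a \<in> D i" for i a using f(2) g(2) that by blast
  have openA: "openin X ?A" using DE by auto
  have "bicontinuous_on X (insert x ?A) g"
    unfolding bicontinuous_on_def
  proof (intro conjI ballI allI impI)
    have "inj_on g ?A"
      using f(1) g(2) unfolding bicontinuous_on_def by (metis (no_types, lifting) inj_on_cong)
    moreover have "g x \<notin> g ` ?A" using gE yE g(1) by fastforce
    ultimately show "inj_on g (insert x ?A)" using xA by (simp add: inj_on_insert)
  next
    fix a V assume a: "a \<in> insert x ?A" and V: "openin X V \<and> g a \<in> V"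
    show "\<exists>U. openin X U \<and> a \<in> U \<and> (\<forall>b\<in>insert x ?A. b \<in> U \<longrightarrow> g b \<in> V)"
    proof (cases "a = x")
      case True
      define J where "J = {i\<in>I. \<not> E i \<subseteq> V}"
      have J: "countable J" unfolding J_def using y(2) V True g by auto
      have "\<forall>i\<in>J. \<exists>N. openin X N \<and> x \<in> N \<and> N \<inter> D i = {}" using x(1) unfolding J_def by blast
      from bchoice[OF this] obtain N where N: "\<And>i. i \<in> J \<Longrightarrow> openin X (N i) \<and> x \<in> N i \<and> N i \<inter> D i = {}"
        by blast
      let ?U = "topspace X \<inter> (\<Inter>i\<in>J. N i)"
      have "g b \<in> V" if b: "b \<in> insert x ?A" "b \<in> ?U" for b
      proof (cases "b = x")
        case False
        then obtain i where i: "i \<in> I" "b \<in> D i" using b by blast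
        then have "i \<notin> J" using b N by blast
        then show ?thesis using gE[OF i] i unfolding J_def by blast
      qed (use V True in auto)
      moreover have "openin X ?U" using J N by (intro openin_countable_INT) auto
      moreover have "a \<in> ?U" using True N xy by auto
      ultimately show ?thesis by (intro exI[of _ ?U]) blast
    next
      case False
      then have a': "a \<in> ?A" using a by blast
      have "f a \<in> V" using V g(2)[OF a'] by simp
      then obtain U where "openin X U" "a \<in> U" "\<forall>b\<in>?A. b \<in> U \<longrightarrow> f b \<in> V"
        using bicontinuous_onD(1)[OF f(1) a'] V by blast
      then show ?thesis using openA a' xA g by (intro exI[of _ "U \<inter> ?A"]) auto
    qed
  next
    fix a U assume a: "a \<in> insert x ?A" and U: "openin X U \<and> a \<in> U"
    show "\<exists>V. openin X V \<and> g a \<in> V \<and> (\<forall>b\<in>insert x ?A. g b \<in> V \<longrightarrow> b \<in> U)"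
    proof (cases "a = x")
      case True
      define J where "J = {i\<in>I. \<not> D i \<subseteq> U}"
      have J: "countable J" unfolding J_def using x(2) U True by auto
      have "\<forall>i\<in>J. \<exists>N. openin X N \<and> y \<in> N \<and> N \<inter> E i = {}" using y(1) unfolding J_def by blast
      from bchoice[OF this] obtain N where N: "\<And>i. i \<in> J \<Longrightarrow> openin X (N i) \<and> y \<in> N i \<and> N i \<inter> E i = {}"
        by blast
      let ?V = "topspace X \<inter> (\<Inter>i\<in>J. N i)"
      have "b \<in> U" if b: "b \<in> insert x ?A" "g b \<in> ?V" for b
      proof (cases "b = x")
        case False
        then obtain i where i: "i \<in> I" "b \<in> D i" using b by blast
        then have "i \<notin> J" using b(2) N gE[OF i] by blast
        then show ?thesis using i unfolding J_def by blast
      qed (use U True in auto)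
      moreover have "openin X ?V" using J N by (intro openin_countable_INT) auto
      moreover have "g a \<in> ?V" using True N xy g by auto
      ultimately show ?thesis by (intro exI[of _ ?V]) blast
    next
      case False
      then obtain i where i: "i \<in> I" "a \<in> D i" using a by blast
      then have a': "a \<in> ?A" by blast
      obtain V where V: "openin X V" "f a \<in> V" "\<forall>b\<in>?A. f b \<in> V \<longrightarrow> b \<in> U"
        using bicontinuous_onD(2)[OF f(1) a'] U by blast
      have "b \<in> U" if "b \<in> insert x ?A" "g b \<in> V \<inter> E i" for b
        using that V(3) g yE[OF i(1)] by (metis IntD1 IntD2 insertE)
      then show ?thesis
        using V gE[OF i] DE i g(2)[OF a'] by (intro exI[of _ "V \<inter> E i"]) auto
    qed
  qed
  moreover have "g ` insert x ?A \<subseteq> insert y (\<Union>i\<in>I. E i)" using g(1) gE by auto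
  ultimately show ?thesis unfolding fits_def by blast
qed

text \<open>Let \<open>G B\<close> be clopen neighbourhoods of \<open>x\<close> indexed by the base and shrinking to \<open>x\<close>. The sets
\<open>D B\<close> of those points of \<open>U\<close> that leave the neighbourhoods at stage \<open>B\<close> are clopen, disjoint, converge to
\<open>x\<close> and exhaust \<open>U - {x}\<close>. As \<open>y\<close> absorbs each of them, copies can be arranged so as to converge to \<open>y\<close>.\<close>

lemma fits_at_point:
  assumes U: "openin X U" "closedin X U" "x \<in> U" and V: "openin X V" "y \<in> V"
    and abs: "\<And>D. openin X D \<Longrightarrow> closedin X D \<Longrightarrow> D \<subseteq> U - {x} \<Longrightarrow> absorbs y D"
  shows "U \<preceq> V"
proof -
  have xy: "x \<in> topspace X" "y \<in> topspace X" using U V openin_subset by blast+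
  have bopen: "openin X B" if "B \<in> \<B>" for B using base that unfolding base_of_def by blast
  have bnbhd: "\<exists>B\<in>\<B>. z \<in> B \<and> B \<subseteq> N" if "openin X N" "z \<in> N" for N z
    using base that unfolding base_of_def by blast
  have "\<forall>B\<in>\<B>. \<exists>K. openin X K \<and> closedin X K \<and> x \<in> K \<and> (x \<in> B \<longrightarrow> K \<subseteq> B)"
    using clopen_nbhd bopen xy by (metis openin_topspace closedin_topspace)
  from bchoice[OF this] obtain G where
    G: "\<And>B. B \<in> \<B> \<Longrightarrow> openin X (G B) \<and> closedin X (G B) \<and> x \<in> G B \<and> (x \<in> B \<longrightarrow> G B \<subseteq> B)" by blast
  define Bel where "Bel B = {C\<in>\<B>. (C, B) \<in> before}" for B
  have Bel: "countable (Bel B)" for B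
    unfolding Bel_def using countable_before by (rule countable_subset[rotated]) blast
  define D where "D B = (U \<inter> (topspace X \<inter> (\<Inter>C\<in>Bel B. G C))) - G B" for B
  \<comment> \<open>\<open>N B\<close> lies in every base neighbourhood of \<open>y\<close> listed up to \<open>B\<close>; so the copies will converge to \<open>y\<close>.\<close>
  define N where "N B = V \<inter> (topspace X \<inter> (\<Inter>C\<in>{C \<in> insert B (Bel B). y \<in> C}. C))" for B
  have openD: "openin X (D B)" if "B \<in> \<B>" for B
    unfolding D_def using that U Bel G
    by (intro openin_diff openin_Int openin_countable_INT) (auto simp: Bel_def)
  have closedD: "closedin X (D B)" if "B \<in> \<B>" for B
    unfolding D_def
  proof (rule closedin_diff[OF closedin_Int])
    show "closedin X (topspace X \<inter> (\<Inter>C\<in>Bel B. G C))"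
    proof (cases "Bel B = {}")
      case False
      then have "closedin X (\<Inter>C\<in>Bel B. G C)" using G unfolding Bel_def by (intro closedin_INT) auto
      then show ?thesis by (rule closedin_Int[OF closedin_topspace])
    qed simp
  qed (use U G that in auto)
  have subD: "D B \<subseteq> U - {x}" if "B \<in> \<B>" for B
  proof -
    have "x \<in> G B" using G[OF that] by blast
    then show ?thesis unfolding D_def by blast
  qed
  have disjD: "disjoint_family_on D \<B>"
    unfolding disjoint_family_on_def
  proof (intro ballI impI)
    fix B C assume "B \<in> \<B>" "C \<in> \<B>" "B \<noteq> C"
    then show "D B \<inter> D C = {}" using before_total[of B C] unfolding D_def Bel_def by blast
  qed
  have UD: "U \<subseteq> insert x (\<Union>B\<in>\<B>. D B)"
  proof
    fix z assume z: "z \<in> U"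
    show "z \<in> insert x (\<Union>B\<in>\<B>. D B)"
    proof (cases "z = x")
      case False
      have zt: "z \<in> topspace X" using z U openin_subset by blast
      have "openin X (topspace X - {z})" using t1 zt by (simp add: t1_space_closedin_singleton openin_diff)
      then obtain B where B: "B \<in> \<B>" "x \<in> B" "B \<subseteq> topspace X - {z}"
        using bnbhd[of "topspace X - {z}" x] False xy by blast
      then have "B \<in> {B\<in>\<B>. z \<notin> G B}" using G by blast
      then have "\<exists>B\<in>{B\<in>\<B>. z \<notin> G B}. \<forall>C. (C, B) \<in> before \<longrightarrow> C \<notin> {B\<in>\<B>. z \<notin> G B}"
        by (rule wf_before[unfolded wf_eq_minimal, rule_format])
      then obtain C where "C \<in> \<B>" "z \<notin> G C" "\<forall>B. (B, C) \<in> before \<longrightarrow> B \<in> \<B> \<longrightarrow> z \<in> G B" by blast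
      then have "z \<in> D C" using z zt unfolding D_def Bel_def by blast
      then show ?thesis using \<open>C \<in> \<B>\<close> by blast
    qed simp
  qed
  have "\<exists>E. disjoint_family_on E \<B> \<and>
     (\<forall>B\<in>\<B>. openin X (E B) \<and> D B \<preceq> E B \<and> E B \<subseteq> N B \<and> (\<exists>W. openin X W \<and> y \<in> W \<and> W \<inter> E B = {}))"
  proof (rule absorbing_recursion[OF wf_before])
    show "countable {j \<in> \<B>. (j, i) \<in> before}" for i using Bel unfolding Bel_def .
    show "(i, j) \<in> before \<or> (j, i) \<in> before" if "i \<in> \<B>" "j \<in> \<B>" "i \<noteq> j" for i j
      using before_total that by blast
    show "absorbs y (D B)" if "B \<in> \<B>" for B using that abs openD closedD subD by blast
    show "openin X (N B) \<and> y \<in> N B" if "B \<in> \<B>" for B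
    proof
      have "countable {C \<in> insert B (Bel B). y \<in> C}"
        using Bel[of B] by (rule countable_subset[rotated, OF countable_insert]) blast
      then show "openin X (N B)"
        unfolding N_def using that V bopen
        by (intro openin_Int openin_countable_INT) (auto simp: Bel_def)
      show "y \<in> N B" unfolding N_def using V xy by blast
    qed
  qed (rule xy)
  then obtain E where E: "disjoint_family_on E \<B>" "\<And>B. B \<in> \<B> \<Longrightarrow> openin X (E B) \<and> D B \<preceq> E B \<and> E B \<subseteq> N B"
      "\<And>B. B \<in> \<B> \<Longrightarrow> \<exists>W. openin X W \<and> y \<in> W \<and> W \<inter> E B = {}" by blast
  have "\<exists>f. bicontinuous_on X (\<Union>B\<in>\<B>. D B) f \<and> (\<forall>B\<in>\<B>. f ` D B \<subseteq> E B)"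
    using disjD openD E(1,2) by (intro fits_sum_map) auto
  then obtain f where f: "bicontinuous_on X (\<Union>B\<in>\<B>. D B) f" "\<And>B. B \<in> \<B> \<Longrightarrow> f ` D B \<subseteq> E B"
    by blast
  have "insert x (\<Union>B\<in>\<B>. D B) \<preceq> insert y (\<Union>B\<in>\<B>. E B)"
  proof (rule one_point_extension[OF f])
    show "\<exists>M. openin X M \<and> x \<in> M \<and> M \<inter> D B = {}" if "B \<in> \<B>" for B
    proof -
      have "G B \<inter> D B = {}" unfolding D_def by blast
      then show ?thesis using G[OF that] by blast
    qed
    show "countable {B\<in>\<B>. \<not> D B \<subseteq> M}" if M: "openin X M" "x \<in> M" for M
    proof -
      obtain B where B: "B \<in> \<B>" "x \<in> B" "B \<subseteq> M" using bnbhd M by blast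
      have "D C \<subseteq> M" if "C \<in> \<B>" "C \<noteq> B" "C \<notin> Bel B" for C
      proof -
        have "B \<in> Bel C" using before_total[of B C] B that unfolding Bel_def by blast
        then have "D C \<subseteq> G B" unfolding D_def by blast
        then show ?thesis using G B by blast
      qed
      then have "{B\<in>\<B>. \<not> D B \<subseteq> M} \<subseteq> insert B (Bel B)" by blast
      then show ?thesis using Bel[of B] by (meson countable_insert countable_subset)
    qed
    show "countable {B\<in>\<B>. \<not> E B \<subseteq> M}" if M: "openin X M" "y \<in> M" for M
    proof -
      obtain B where B: "B \<in> \<B>" "y \<in> B" "B \<subseteq> M" using bnbhd M by blast
      have "E C \<subseteq> M" if "C \<in> \<B>" "C \<noteq> B" "C \<notin> Bel B" for C
      proof -
        have "B \<in> Bel C" using before_total[of B C] B that unfolding Bel_def by blast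
        then have "N C \<subseteq> B" using B unfolding N_def by blast
        then show ?thesis using E(2) B that by blast
      qed
      then have "{B\<in>\<B>. \<not> E B \<subseteq> M} \<subseteq> insert B (Bel B)" by blast
      then show ?thesis using Bel[of B] by (meson countable_insert countable_subset)
    qed
  qed (use E openD xy in auto)
  moreover have "insert y (\<Union>B\<in>\<B>. E B) \<subseteq> V" using V E(2) unfolding N_def by blast
  ultimately show ?thesis using fits_mono[OF _ UD] by blast
qed

text \<open>A maximal disjoint family of clopen sets that meet \<open>S\<close> and avoid \<open>y\<close> cannot be countable: the complement
of its union would be a neighbourhood of \<open>y\<close>, and would contain another point of \<open>S\<close>.\<close>

lemma uncountable_family_near_limit:
  assumes S: "S \<subseteq> topspace X" "y \<in> derived X S" and V: "openin X V" "y \<in> V"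
  shows "\<exists>\<Q>. uncountable \<Q> \<and> disjoint \<Q> \<and> (\<forall>Q\<in>\<Q>. openin X Q \<and> Q \<subseteq> V \<and> Q \<inter> S \<noteq> {})"
proof -
  define \<A> where "\<A> = {\<Q>. disjoint \<Q> \<and> (\<forall>Q\<in>\<Q>. openin X Q \<and> closedin X Q \<and> Q \<subseteq> V - {y} \<and> Q \<inter> S \<noteq> {})}"
  have "\<exists>M\<in>\<A>. \<forall>Q\<in>\<A>. M \<subseteq> Q \<longrightarrow> Q = M"
  proof (rule subset_Zorn')
    fix C assume C: "subset.chain \<A> C"
    then have CA: "C \<subseteq> \<A>" and ch: "\<And>P Q. P \<in> C \<Longrightarrow> Q \<in> C \<Longrightarrow> P \<subseteq> Q \<or> Q \<subseteq> P"
      unfolding subset_chain_def by blast+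
    have "disjoint (\<Union>C)"
    proof (rule disjointI)
      fix P Q assume "P \<in> \<Union>C" "Q \<in> \<Union>C" and ne: "P \<noteq> Q"
      then obtain \<P> \<Q> where "\<P> \<in> C" "P \<in> \<P>" "\<Q> \<in> C" "Q \<in> \<Q>" by blast
      then obtain \<R> where "\<R> \<in> C" "P \<in> \<R>" "Q \<in> \<R>" using ch[of \<P> \<Q>] by blast
      moreover have "disjoint \<R>" using \<open>\<R> \<in> C\<close> CA unfolding \<A>_def by blast
      ultimately show "P \<inter> Q = {}" using ne by (meson disjointD)
    qed
    moreover have "\<forall>Q\<in>\<Union>C. openin X Q \<and> closedin X Q \<and> Q \<subseteq> V - {y} \<and> Q \<inter> S \<noteq> {}"
      using CA unfolding \<A>_def by blast
    ultimately show "\<Union>C \<in> \<A>" unfolding \<A>_def by blast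
  qed
  then obtain M where M: "M \<in> \<A>" "\<And>Q. Q \<in> \<A> \<Longrightarrow> M \<subseteq> Q \<Longrightarrow> Q = M" by blast
  have Mp: "disjoint M" "\<And>Q. Q \<in> M \<Longrightarrow> openin X Q \<and> closedin X Q \<and> Q \<subseteq> V - {y} \<and> Q \<inter> S \<noteq> {}"
    using M(1) unfolding \<A>_def by blast+
  have "uncountable M"
  proof
    assume "countable M"
    then have "closedin X (\<Union>Q\<in>M. Q)" using Mp by (intro closedin_countable_UN) auto
    then have N: "openin X (V - \<Union>M)" "y \<in> V - \<Union>M" using V Mp(2) by (auto intro: openin_diff)
    then obtain z where z: "z \<in> S" "z \<in> V - \<Union>M" "z \<noteq> y" using S(2) unfolding derived_iff[OF S(1)] by blast
    have yt: "y \<in> topspace X" using V openin_subset by blast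
    have "openin X (V - \<Union>M - {y})" using N yt t1 by (simp add: t1_space_closedin_singleton openin_diff)
    then obtain K where K: "openin X K" "closedin X K" "z \<in> K" "K \<subseteq> V - \<Union>M - {y}"
      using clopen_nbhd[of "V - \<Union>M - {y}" z] z by blast
    have "K \<inter> Q = {}" if "Q \<in> M" for Q using K(4) that by blast
    then have "disjoint (insert K M)"
      using Mp(1) by (auto simp: disjoint_def pairwise_insert disjnt_def Int_commute)
    moreover have "K \<inter> S \<noteq> {}" "K \<subseteq> V - {y}" using K z by blast+
    ultimately have "insert K M \<in> \<A>" using Mp(2) K(1,2) unfolding \<A>_def by simp
    then have "insert K M = M" by (rule M(2)) blast
    then have "K \<in> M" by blast
    then show False using K by blast
  qed
  then show ?thesis using Mp by (intro exI[of _ M]) blast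
qed

end

section \<open>Open sets of distant ranks\<close>

lemma closedin_funpow_derived: "closedin X M \<Longrightarrow> closedin X ((derived X ^^ n) M)"
  by (induction n) (auto intro: closedin_derived)

lemma funpow_derived_subset: "(derived X ^^ n) M \<subseteq> M"
  by (induction n) (use derived_subset in fastforce)+

context omega1_P_space
begin

lemma fits_uncountable_family:
  assumes P: "disjoint \<P>" "\<And>P. P \<in> \<P> \<Longrightarrow> openin X P \<and> P \<noteq> {}"
    and Q: "uncountable \<Q>" "disjoint \<Q>" "\<And>Q. Q \<in> \<Q> \<Longrightarrow> openin X Q"
    and fit: "\<And>P Q. P \<in> \<P> \<Longrightarrow> Q \<in> \<Q> \<Longrightarrow> P \<preceq> Q"
  shows "\<Union>\<P> \<preceq> \<Union>\<Q>"
proof -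
  obtain \<phi> where \<phi>: "inj_on \<phi> \<P>" "\<phi> ` \<P> \<subseteq> \<Q>"
    using disjoint_open_inj_into_uncountable[OF P Q(1)] by blast
  have "(\<Union>P\<in>\<P>. P) \<preceq> (\<Union>P\<in>\<P>. \<phi> P)"
  proof (rule fits_sum)
    show "disjoint_family_on (\<lambda>P. P) \<P>"
      using P(1) unfolding disjoint_family_on_def by (meson disjointD)
    show "disjoint_family_on \<phi> \<P>"
      unfolding disjoint_family_on_def
    proof (intro ballI impI)
      fix A B assume "A \<in> \<P>" "B \<in> \<P>" "A \<noteq> B"
      then have "\<phi> A \<in> \<Q>" "\<phi> B \<in> \<Q>" "\<phi> A \<noteq> \<phi> B"
        using \<phi> by (blast, blast, metis inj_onD)
      then show "\<phi> A \<inter> \<phi> B = {}" using Q(2) by (meson disjointD)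
    qed
  qed (use P Q \<phi> fit in blast)+
  then show ?thesis by (rule fits_mono) (use \<phi> in auto)
qed

text \<open>The points of \<open>A \<inter> S\<close> are isolated in \<open>S\<close>, so \<open>A\<close> can be cut into clopen pieces each containing at most
one of them.\<close>

lemma isolating_pieces:
  assumes A: "openin X A" and S: "closedin X S" "A \<inter> derived X S = {}"
    and U: "\<And>x. x \<in> A \<inter> S \<Longrightarrow> openin X (U x) \<and> x \<in> U x"
  shows "\<exists>\<O>. disjoint \<O> \<and> \<Union>\<O> = A \<and> (\<forall>Q\<in>\<O>. openin X Q \<and> closedin X Q \<and> Q \<noteq> {} \<and>
     (Q \<inter> S = {} \<or> (\<exists>x\<in>A \<inter> S. Q \<inter> S = {x} \<and> Q \<subseteq> U x)))"
proof -
  have St: "S \<subseteq> topspace X" using S(1) by (rule closedin_subset)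
  have "\<exists>N. openin X N \<and> x \<in> N \<and> (\<forall>z\<in>S. z \<in> N \<longrightarrow> z = x)" if "x \<in> A \<inter> S" for x
  proof -
    have "x \<notin> derived X S" "x \<in> S" using that S(2) by blast+
    then show ?thesis unfolding derived_iff[OF St] by blast
  qed
  then have "\<forall>x\<in>A \<inter> S. \<exists>N. openin X N \<and> x \<in> N \<and> (\<forall>z\<in>S. z \<in> N \<longrightarrow> z = x)" by blast
  from bchoice[OF this] obtain N where
    N: "\<And>x. x \<in> A \<inter> S \<Longrightarrow> openin X (N x) \<and> x \<in> N x \<and> (\<forall>z\<in>S. z \<in> N x \<longrightarrow> z = x)" by blast
  define C where "C x = A \<inter> N x \<inter> U x" for x
  have C: "openin X (C x)" "x \<in> C x" "C x \<inter> S \<subseteq> {x}" "C x \<subseteq> U x" "C x \<subseteq> A" if "x \<in> A \<inter> S" for x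
    using A N[OF that] U[OF that] that unfolding C_def by auto
  let ?C = "insert (A - S) (C ` (A \<inter> S))"
  have "openin X T" if "T \<in> ?C" for T using that A S C by auto
  from disjoint_refinement[of ?C, OF this] obtain \<O> where O: "disjoint \<O>" "\<Union>\<O> = \<Union>?C"
      "\<forall>Q\<in>\<O>. openin X Q \<and> closedin X Q \<and> Q \<noteq> {} \<and> (\<exists>C\<in>?C. Q \<subseteq> C)" by blast
  have "\<Union>?C = A"
  proof (intro equalityI subsetI)
    fix z assume z: "z \<in> A"
    show "z \<in> \<Union>?C" using z C(2)[of z] by (cases "z \<in> S") auto
  qed (use C(5) in auto)
  moreover have "Q \<inter> S = {} \<or> (\<exists>x\<in>A \<inter> S. Q \<inter> S = {x} \<and> Q \<subseteq> U x)" if Q: "Q \<in> \<O>" for Q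
  proof (cases "Q \<inter> S = {}")
    case False
    then have "\<not> Q \<subseteq> A - S" by blast
    then obtain x where x: "x \<in> A \<inter> S" "Q \<subseteq> C x" using O(3) Q by blast
    then have "Q \<inter> S \<subseteq> {x}" "Q \<subseteq> U x" using C(3,4)[OF x(1)] by blast+
    then show ?thesis using False x(1) by blast
  qed simp
  ultimately show ?thesis using O by (intro exI[of _ \<O>]) simp
qed

text \<open>Relative to an absorbing \<open>M\<close> the open sets that miss \<open>M\<close> are negligible: they fit next to any point of \<open>M\<close>.
The whole space is absorbing because only the empty set misses it; the other examples arise at limit
stages.\<close>

definition absorbing :: "'a set \<Rightarrow> bool" where
  "absorbing M \<longleftrightarrow> closedin X M \<and> (\<forall>P y. openin X P \<and> P \<inter> M = {} \<and> y \<in> M \<longrightarrow> absorbs y P)"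

text \<open>Induction on \<open>n\<close>. By \<open>isolating_pieces\<close> the set \<open>P\<close> splits into pieces with at most one point of the top
level. Such a piece embeds near any point that is a limit of points at level \<open>2 * n\<close>, by \<open>fits_at_point\<close>
and the induction hypothesis; and a limit of points of that kind has an uncountable disjoint family of
neighbourhoods of them nearby, which receives all the pieces. The two limits account for the factor two.\<close>

lemma fits_near_derived:
  assumes M: "absorbing M"
    and P: "openin X P" "P \<inter> (derived X ^^ n) M = {}"
    and y: "y \<in> (derived X ^^ (2 * n)) M" "openin X V" "y \<in> V"
  shows "P \<preceq> V"
  using P y
proof (induction n arbitrary: P y V)
  case 0
  then show ?case using M absorbs_imp_fits unfolding absorbing_def by simp blast
next
  case (Suc n)
  define S where "S = (derived X ^^ n) M"
  define T where "T = (derived X ^^ (2 * n)) M"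
  have cl: "closedin X S" "closedin X T" "closedin X (derived X T)"
    using M unfolding absorbing_def S_def T_def
    by (auto intro: closedin_funpow_derived closedin_derived)
  have tt: "T \<subseteq> topspace X" "derived X T \<subseteq> topspace X" using cl closedin_subset by blast+
  have y: "y \<in> derived X (derived X T)" using Suc.prems(3) unfolding T_def by simp
  have PS: "P \<inter> derived X S = {}" using Suc.prems(2) unfolding S_def by simp
  have IH: "D \<preceq> N" if "openin X D" "D \<inter> S = {}" "z \<in> T" "openin X N" "z \<in> N" for D N z
    using Suc.IH that unfolding S_def T_def by blast
  have "\<exists>\<O>. disjoint \<O> \<and> \<Union>\<O> = P \<and> (\<forall>Q\<in>\<O>. openin X Q \<and> closedin X Q \<and> Q \<noteq> {} \<and>
     (Q \<inter> S = {} \<or> (\<exists>x\<in>P \<inter> S. Q \<inter> S = {x} \<and> Q \<subseteq> topspace X)))"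
  proof (rule isolating_pieces[OF Suc.prems(1) cl(1) PS])
    show "openin X (topspace X) \<and> x \<in> topspace X" if "x \<in> P \<inter> S" for x
      using that closedin_subset[OF cl(1)] by blast
  qed
  then obtain \<O> where O12: "disjoint \<O>" "\<Union>\<O> = P"
    and O3: "\<forall>Q\<in>\<O>. openin X Q \<and> closedin X Q \<and> Q \<noteq> {} \<and>
      (Q \<inter> S = {} \<or> (\<exists>x\<in>P \<inter> S. Q \<inter> S = {x} \<and> Q \<subseteq> topspace X))" by (elim exE conjE)
  have O: "openin X Q \<and> closedin X Q \<and> Q \<noteq> {} \<and> (Q \<inter> S = {} \<or> (\<exists>x. Q \<inter> S = {x}))" if "Q \<in> \<O>" for Q
    using O12 O3[rule_format, OF that] by auto
  have piece: "Q \<preceq> N" if Q: "Q \<in> \<O>" and N: "openin X N" "z \<in> N" and z: "z \<in> derived X T" for Q N z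
  proof (cases "Q \<inter> S = {}")
    case True
    have "z \<in> T" using z derived_subset[of X T] by blast
    then show ?thesis using IH[OF _ True] N O[OF Q] by blast
  next
    case False
    then obtain x where x: "Q \<inter> S = {x}" using O[OF Q] by blast
    show ?thesis
    proof (rule fits_at_point[of Q x])
      fix D assume D: "openin X D" "D \<subseteq> Q - {x}"
      show "absorbs z D"
      proof (rule absorbsI)
        fix V' assume V': "openin X V'" "z \<in> V'"
        then obtain z' where z': "z' \<in> T" "z' \<in> V'" "z' \<noteq> z" using z unfolding derived_iff[OF tt(1)] by blast
        \<comment> \<open>A copy near another point \<open>z'\<close> of \<open>T\<close> can be separated from \<open>z\<close>.\<close>
        have "openin X (V' - {z})"
          using V' t1 openin_subset by (intro openin_diff) (auto simp: t1_space_closedin_singleton)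
        then obtain K where K: "openin X K" "closedin X K" "z' \<in> K" "K \<subseteq> V' - {z}"
          using clopen_nbhd[of "V' - {z}" z'] z' by blast
        have "D \<inter> S = {}" using D x by blast
        then have "D \<preceq> K" using IH[OF D(1) _ z'(1)] K by blast
        moreover have "K \<subseteq> V' - (topspace X - K)" using K by blast
        ultimately have "D \<preceq> V' - (topspace X - K)" using fits_mono[OF _ subset_refl] by metis
        moreover have "z \<in> topspace X - K" using V' openin_subset K by blast
        ultimately show "\<exists>W. openin X W \<and> z \<in> W \<and> D \<preceq> V' - W"
          using K by (intro exI[of _ "topspace X - K"]) auto
      qed
    qed (use x N O[OF Q] in blast)+
  qed
  obtain \<Q> where Q: "uncountable \<Q>" "disjoint \<Q>"
      "\<And>Q. Q \<in> \<Q> \<Longrightarrow> openin X Q \<and> Q \<subseteq> V \<and> Q \<inter> derived X T \<noteq> {}"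
    using uncountable_family_near_limit[OF tt(2) y Suc.prems(4,5)] by blast
  have "\<Union>\<O> \<preceq> \<Union>\<Q>"
  proof (rule fits_uncountable_family[OF O12(1) _ Q(1,2)])
    fix R Q assume "R \<in> \<O>" "Q \<in> \<Q>"
    then show "R \<preceq> Q" using piece Q(3) by blast
  qed (use O Q(3) in blast)+
  then show ?case by (rule fits_mono) (use O12(2) Q(3) in blast)+
qed

section \<open>Finitely many building blocks\<close>

text \<open>The point \<open>y\<close> absorbs the disjoint sum of uncountably many copies of \<open>N\<close>. The copies are described by the
disjoint open sets that contain them, as the sum need not be represented by a subset of \<open>X\<close>.\<close>

definition absorbs_many :: "'a \<Rightarrow> 'a set \<Rightarrow> bool" where
  "absorbs_many y N \<longleftrightarrow> (\<forall>V. openin X V \<and> y \<in> V \<longrightarrow> (\<exists>W \<Q>. openin X W \<and> y \<in> W \<and>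
     uncountable \<Q> \<and> disjoint \<Q> \<and> (\<forall>Q\<in>\<Q>. openin X Q \<and> Q \<subseteq> V - W \<and> N \<preceq> Q)))"

abbreviation interfit (infix "\<simeq>" 50) where "A \<simeq> B \<equiv> A \<preceq> B \<and> B \<preceq> A"

text \<open>The sets in \<open>\<N>\<close> serve as building blocks, and only their embeddability class matters.\<close>

definition decomposes :: "'a set set \<Rightarrow> 'a set \<Rightarrow> bool" where
  "decomposes \<N> A \<longleftrightarrow> (\<exists>\<P>. disjoint \<P> \<and> \<Union>\<P> = A \<and>
     (\<forall>P\<in>\<P>. openin X P \<and> P \<noteq> {} \<and> (\<exists>N\<in>\<N>. P \<simeq> N)))"

text \<open>All that the embeddings below depend on about the way in which points of lower levels accumulate at \<open>x\<close>.
For finite \<open>\<N>\<close> it takes finitely many values.\<close>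

definition local_type :: "'a set set \<Rightarrow> 'a \<Rightarrow> 'a set set \<times> 'a set set" where
  "local_type \<N> x = ({N\<in>\<N>. absorbs x N}, {N\<in>\<N>. absorbs_many x N})"

text \<open>Group the pieces of \<open>D\<close> by building block. A countable group is absorbed by \<open>absorbs_countable_UN\<close>, an
uncountable one by the assumption on uncountable families, and the finitely many groups together
again by \<open>absorbs_countable_UN\<close>.\<close>

lemma absorbs_decomposed:
  assumes fin: "finite \<N>" and D: "openin X D" "decomposes \<N> D" and y: "y \<in> topspace X"
    and one: "\<And>N. N \<in> \<N> \<Longrightarrow> N \<preceq> D \<Longrightarrow> absorbs y N"
    and many: "\<And>N \<Q>. N \<in> \<N> \<Longrightarrow> uncountable \<Q> \<Longrightarrow> disjoint \<Q> \<Longrightarrow>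
       \<forall>Q\<in>\<Q>. openin X Q \<and> Q \<subseteq> D \<and> N \<preceq> Q \<Longrightarrow> absorbs_many y N"
  shows "absorbs y D"
proof -
  obtain \<P> where P: "disjoint \<P>" "\<Union>\<P> = D" "\<And>P. P \<in> \<P> \<Longrightarrow> openin X P \<and> P \<noteq> {}"
      and "\<forall>P\<in>\<P>. \<exists>N. N \<in> \<N> \<and> P \<simeq> N"
    using D(2) unfolding decomposes_def by blast
  from bchoice[OF this(4)] obtain \<nu> where \<nu>: "\<And>P. P \<in> \<P> \<Longrightarrow> \<nu> P \<in> \<N> \<and> P \<simeq> \<nu> P" by blast
  define cls where "cls N = {P\<in>\<P>. \<nu> P = N}" for N
  have clsP: "disjoint (cls N)" "\<And>P. P \<in> cls N \<Longrightarrow> openin X P \<and> P \<noteq> {} \<and> P \<simeq> N \<and> P \<subseteq> D" for N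
    using P \<nu> unfolding cls_def by (auto intro: pairwise_subset)
  have cls: "absorbs y (\<Union>P\<in>cls N. P)" if N: "N \<in> \<N>" for N
  proof (cases "countable (cls N)")
    case True
    show ?thesis
    proof (rule absorbs_countable_UN[OF True])
      show "disjoint_family_on (\<lambda>P. P) (cls N)"
        using clsP(1) unfolding disjoint_family_on_def by (meson disjointD)
      show "absorbs y P" if "P \<in> cls N" for P
      proof -
        have "N \<preceq> D" using clsP(2)[OF that] fits_mono by blast
        then show ?thesis using one[OF N] absorbs_mono clsP(2)[OF that] by blast
      qed
    qed (use clsP y in blast)+
  next
    case False
    have m: "absorbs_many y N" using clsP by (intro many[OF N False]) auto
    show ?thesis
    proof (rule absorbsI)
      fix V assume "openin X V" "y \<in> V"
      then obtain W \<Q> where Q: "openin X W" "y \<in> W" "uncountable \<Q>" "disjoint \<Q>"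
          "\<And>Q. Q \<in> \<Q> \<Longrightarrow> openin X Q \<and> Q \<subseteq> V - W \<and> N \<preceq> Q"
        using m unfolding absorbs_many_def by (metis (no_types, lifting))
      have "\<Union>(cls N) \<preceq> \<Union>\<Q>"
      proof (rule fits_uncountable_family[OF clsP(1) _ Q(3,4)])
        fix R Q assume "R \<in> cls N" "Q \<in> \<Q>"
        then show "R \<preceq> Q" using clsP(2) Q(5) fits_trans by blast
      qed (use clsP(2) Q(5) in blast)+
      then have "(\<Union>P\<in>cls N. P) \<preceq> V - W" by (rule fits_mono) (use Q(5) in auto)
      then show "\<exists>W. openin X W \<and> y \<in> W \<and> (\<Union>P\<in>cls N. P) \<preceq> V - W" using Q by blast
    qed
  qed
  have "absorbs y (\<Union>N\<in>\<N>. \<Union>P\<in>cls N. P)"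
  proof (rule absorbs_countable_UN)
    show "countable \<N>" using fin by (rule countable_finite)
    show "disjoint_family_on (\<lambda>N. \<Union>P\<in>cls N. P) \<N>"
      unfolding disjoint_family_on_def
    proof (intro ballI impI)
      fix N N' :: "'a set" assume "N \<noteq> N'"
      have "P \<inter> Q = {}" if "P \<in> cls N" "Q \<in> cls N'" for P Q
        using that \<open>N \<noteq> N'\<close> P(1) unfolding cls_def by (metis (mono_tags, lifting) disjointD mem_Collect_eq)
      then show "(\<Union>P\<in>cls N. P) \<inter> (\<Union>P\<in>cls N'. P) = {}" by blast
    qed
    show "openin X (\<Union>P\<in>cls N. P)" for N using clsP(2) by blast
  qed (use y cls in blast)+
  moreover have "(\<Union>N\<in>\<N>. \<Union>P\<in>cls N. P) = D" using P(2) \<nu> unfolding cls_def by auto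
  ultimately show ?thesis by simp
qed

text \<open>Choose the neighbourhood \<open>U\<close> of \<open>x\<close> so small that, away from \<open>x\<close>, it has no copy of any \<open>N\<close> that \<open>x\<close>
does not absorb, and no uncountable family of copies of any \<open>N\<close> that \<open>x\<close> does not absorb uncountably
often. Finitely many \<open>N\<close> impose finitely many such conditions. Then whatever occurs in a clopen part of
\<open>U - {x}\<close> is absorbed by \<open>x\<close>, hence by every \<open>y\<close> of the same type, and \<open>fits_at_point\<close> applies.\<close>

lemma type_determines_neighbourhood:
  assumes M: "absorbing M" and fin: "finite \<N>"
    and dec: "\<And>A. openin X A \<Longrightarrow> A \<inter> (derived X ^^ n) M = {} \<Longrightarrow> A \<inter> M \<noteq> {} \<Longrightarrow> decomposes \<N> A"
    and x: "x \<in> (derived X ^^ n) M" "x \<notin> (derived X ^^ Suc n) M"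
  shows "\<exists>U. openin X U \<and> x \<in> U \<and>
     (\<forall>y\<in>(derived X ^^ n) M. local_type \<N> y = local_type \<N> x \<longrightarrow> (\<forall>V. openin X V \<and> y \<in> V \<longrightarrow> U \<preceq> V))"
proof -
  define S where "S = (derived X ^^ n) M"
  have SM: "S \<subseteq> M" unfolding S_def by (rule funpow_derived_subset)
  have clS: "closedin X S" using M unfolding S_def absorbing_def by (blast intro: closedin_funpow_derived)
  have St: "S \<subseteq> topspace X" using clS by (rule closedin_subset)
  have xS: "x \<in> S" "x \<notin> derived X S" using x unfolding S_def by simp_all
  obtain N0 where N0: "openin X N0" "x \<in> N0" "\<forall>z\<in>S. z \<in> N0 \<longrightarrow> z = x"
    using xS unfolding derived_iff[OF St] by blast
  have "\<forall>N\<in>\<N>. \<exists>V. openin X V \<and> x \<in> V \<and>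
      (\<not> absorbs x N \<longrightarrow> (\<forall>W. openin X W \<and> x \<in> W \<longrightarrow> \<not> N \<preceq> V - W))"
    using absorbsI[of x] openin_topspace xS(1) St by (metis subsetD)
  from bchoice[OF this] obtain V1 where V1: "\<And>N. N \<in> \<N> \<Longrightarrow> openin X (V1 N) \<and> x \<in> V1 N \<and>
      (\<not> absorbs x N \<longrightarrow> (\<forall>W. openin X W \<and> x \<in> W \<longrightarrow> \<not> N \<preceq> V1 N - W))" by blast
  define E where "E V N \<longleftrightarrow> (\<exists>W \<Q>. openin X W \<and> x \<in> W \<and>
     uncountable \<Q> \<and> disjoint \<Q> \<and> (\<forall>Q\<in>\<Q>. openin X Q \<and> Q \<subseteq> V - W \<and> N \<preceq> Q))" for V N
  have E: "absorbs_many x N \<longleftrightarrow> (\<forall>V. openin X V \<and> x \<in> V \<longrightarrow> E V N)" for N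
    unfolding absorbs_many_def E_def by (rule refl)
  have "\<forall>N\<in>\<N>. \<exists>V. openin X V \<and> x \<in> V \<and> (\<not> absorbs_many x N \<longrightarrow> \<not> E V N)"
    using E openin_topspace xS(1) St by (metis subsetD)
  from bchoice[OF this] obtain V2 where V2: "\<And>N. N \<in> \<N> \<Longrightarrow> openin X (V2 N) \<and> x \<in> V2 N \<and>
      (\<not> absorbs_many x N \<longrightarrow> \<not> E (V2 N) N)" by blast
  let ?I = "topspace X \<inter> (\<Inter>N\<in>\<N>. V1 N \<inter> V2 N)"
  have V12: "openin X (V1 N \<inter> V2 N)" "x \<in> V1 N \<inter> V2 N" if "N \<in> \<N>" for N
    using V1[OF that] V2[OF that] by (blast intro: openin_Int)+
  have "openin X ?I" using fin V12(1) by (intro openin_countable_INT) (rule countable_finite)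
  then have "openin X (N0 \<inter> ?I)" using N0(1) by (rule openin_Int[rotated])
  moreover have "x \<in> N0 \<inter> ?I" using N0(2) V12(2) xS(1) St by blast
  ultimately obtain U where U: "openin X U" "closedin X U" "x \<in> U" "U \<subseteq> N0 \<inter> ?I" using clopen_nbhd by meson
  have UV: "U \<subseteq> V1 N" "U \<subseteq> V2 N" if "N \<in> \<N>" for N using U(4) that by blast+
  have "U \<preceq> V" if y: "y \<in> S" and type: "local_type \<N> y = local_type \<N> x" and V: "openin X V" "y \<in> V" for y V
  proof (rule fits_at_point[OF U(1-3) V])
    fix D assume D: "openin X D" "closedin X D" "D \<subseteq> U - {x}"
    have yt: "y \<in> topspace X" using y St by blast
    have DS: "D \<inter> S = {}" using D(3) U(4) N0(3) by blast
    show "absorbs y D"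
    proof (cases "D \<inter> M = {}")
      case True
      then show ?thesis using M D(1) y SM unfolding absorbing_def by blast
    next
      case False
      let ?W = "topspace X - D"
      have W: "openin X ?W" "x \<in> ?W" using D xS St by auto
      have DW: "D \<subseteq> U - ?W" using D by blast
      have eq: "absorbs y N = absorbs x N" "absorbs_many y N = absorbs_many x N" if "N \<in> \<N>" for N
        using type that unfolding local_type_def by blast+
      show ?thesis
      proof (rule absorbs_decomposed[OF fin D(1) _ yt])
        show "decomposes \<N> D" using dec[OF D(1)] DS False unfolding S_def by blast
        show "absorbs y N" if N: "N \<in> \<N>" "N \<preceq> D" for N
        proof -
          have "D \<subseteq> V1 N - ?W" using DW UV(1)[OF N(1)] by blast
          then have "N \<preceq> V1 N - ?W" by (rule fits_mono[OF N(2) subset_refl])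
          then show ?thesis using V1[OF N(1)] W eq[OF N(1)] by blast
        qed
        show "absorbs_many y N" if N: "N \<in> \<N>" and Q: "uncountable \<Q>" "disjoint \<Q>"
            "\<forall>Q\<in>\<Q>. openin X Q \<and> Q \<subseteq> D \<and> N \<preceq> Q" for N \<Q>
        proof -
          have "D \<subseteq> V2 N - ?W" using DW UV(2)[OF N(1)] by blast
          then have "\<forall>Q\<in>\<Q>. openin X Q \<and> Q \<subseteq> V2 N - ?W \<and> N \<preceq> Q" using Q(3) by blast
          then have "E (V2 N) N" unfolding E_def using W Q(1,2) by (intro exI conjI)
          then show ?thesis using V2[OF N(1)] eq(2)[OF N(1)] by blast
        qed
      qed
    qed
  qed
  then show ?thesis using U unfolding S_def by (intro exI[of _ U]) blast
qed

text \<open>The blocks of level \<open>n + 1\<close> are those of level \<open>n\<close> and one small neighbourhood \<open>R x\<close> for each type of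
points of the top level. A part \<open>B\<close> of the set below the top level is decomposed by the induction
hypothesis if it meets \<open>M\<close>. Otherwise it is negligible, and is merged with one of the pieces around a top
point, whose block absorbs it; such a piece exists since the whole set meets \<open>M\<close>.\<close>

lemma decomposition:
  assumes M: "absorbing M"
  shows "\<exists>\<N>. finite \<N> \<and> (\<forall>A. openin X A \<and> A \<inter> (derived X ^^ n) M = {} \<and> A \<inter> M \<noteq> {} \<longrightarrow> decomposes \<N> A)"
proof (induction n)
  case 0
  show ?case by (rule exI[of _ "{}"]) auto
next
  case (Suc n)
  then obtain \<N> where fin: "finite \<N>" and
    dec: "\<And>A. openin X A \<Longrightarrow> A \<inter> (derived X ^^ n) M = {} \<Longrightarrow> A \<inter> M \<noteq> {} \<Longrightarrow> decomposes \<N> A"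
    by blast
  define S where "S = (derived X ^^ n) M"
  have clS: "closedin X S" using M unfolding S_def absorbing_def by (blast intro: closedin_funpow_derived)
  have SM: "S \<subseteq> M" unfolding S_def by (rule funpow_derived_subset)
  define T where "T = S - derived X S"
  have "\<forall>x\<in>T. \<exists>U. openin X U \<and> x \<in> U \<and>
     (\<forall>y\<in>S. local_type \<N> y = local_type \<N> x \<longrightarrow> (\<forall>V. openin X V \<and> y \<in> V \<longrightarrow> U \<preceq> V))"
  proof
    fix x assume "x \<in> T"
    then have x: "x \<in> (derived X ^^ n) M" "x \<notin> (derived X ^^ Suc n) M" unfolding T_def S_def by simp_all
    show "\<exists>U. openin X U \<and> x \<in> U \<and>
     (\<forall>y\<in>S. local_type \<N> y = local_type \<N> x \<longrightarrow> (\<forall>V. openin X V \<and> y \<in> V \<longrightarrow> U \<preceq> V))"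
      unfolding S_def
    proof (rule type_determines_neighbourhood[OF M fin _ x])
      show "decomposes \<N> A"
        if "openin X A" "A \<inter> (derived X ^^ n) M = {}" "A \<inter> M \<noteq> {}" for A
        using that by (rule dec)
    qed
  qed
  from bchoice[OF this] obtain U where U: "\<And>x. x \<in> T \<Longrightarrow> openin X (U x) \<and> x \<in> U x"
    and Ufit: "\<And>x y V. x \<in> T \<Longrightarrow> y \<in> S \<Longrightarrow> local_type \<N> y = local_type \<N> x \<Longrightarrow>
      openin X V \<Longrightarrow> y \<in> V \<Longrightarrow> U x \<preceq> V" by blast
  define rep where "rep t = (SOME x. x \<in> T \<and> local_type \<N> x = t)" for t
  have rep: "rep (local_type \<N> x) \<in> T \<and> local_type \<N> (rep (local_type \<N> x)) = local_type \<N> x" if "x \<in> T" for x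
    unfolding rep_def by (rule someI[of _ x]) (use that in simp)
  define R where "R x = U (rep (local_type \<N> x))" for x
  have "local_type \<N> ` T \<subseteq> Pow \<N> \<times> Pow \<N>" unfolding local_type_def by blast
  then have "finite (local_type \<N> ` T)" using fin by (meson finite_Pow_iff finite_SigmaI finite_subset)
  moreover have "R ` T = (\<lambda>t. U (rep t)) ` (local_type \<N> ` T)" unfolding R_def by auto
  ultimately have finR: "finite (R ` T)" by simp
  have R: "U x \<preceq> R x" "openin X (R x)" if "x \<in> T" for x
  proof -
    note r = rep[OF that]
    show "openin X (R x)" using U r unfolding R_def by blast
    show "U x \<preceq> R x"
      unfolding R_def using r U[of "rep (local_type \<N> x)"]
      by (intro Ufit[OF that, of "rep (local_type \<N> x)"]) (auto simp: T_def)
  qed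
  have RO: "R x \<preceq> Q" if "x \<in> T" "openin X Q" "x \<in> Q" for x Q
    unfolding R_def using rep[OF that(1)] that
    by (intro Ufit[of "rep (local_type \<N> x)" x]) (auto simp: T_def)
  have "decomposes (\<N> \<union> R ` T) A"
    if A: "openin X A" "A \<inter> (derived X ^^ Suc n) M = {}" "A \<inter> M \<noteq> {}" for A
  proof -
    have AS: "A \<inter> derived X S = {}" using A(2) unfolding S_def by simp
    have AT: "A \<inter> S \<subseteq> T" using AS unfolding T_def by blast
    have "\<exists>\<O>. disjoint \<O> \<and> \<Union>\<O> = A \<and> (\<forall>Q\<in>\<O>. openin X Q \<and> closedin X Q \<and> Q \<noteq> {} \<and>
        (Q \<inter> S = {} \<or> (\<exists>x\<in>A \<inter> S. Q \<inter> S = {x} \<and> Q \<subseteq> U x)))"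
      using U AT by (intro isolating_pieces[OF A(1) clS AS]) blast
    then obtain \<O> where O: "disjoint \<O>" "\<Union>\<O> = A"
      and O3: "\<forall>Q\<in>\<O>. openin X Q \<and> closedin X Q \<and> Q \<noteq> {} \<and>
        (Q \<inter> S = {} \<or> (\<exists>x\<in>A \<inter> S. Q \<inter> S = {x} \<and> Q \<subseteq> U x))" by (elim exE conjE)
    have openO: "openin X Q" "Q \<noteq> {}" if "Q \<in> \<O>" for Q using O3 that by blast+
    define \<O>1 where "\<O>1 = {Q\<in>\<O>. Q \<inter> S \<noteq> {}}"
    define B where "B = \<Union>{Q\<in>\<O>. Q \<inter> S = {}}"
    have top: "\<exists>x\<in>T. x \<in> Q \<and> Q \<subseteq> U x" if "Q \<in> \<O>1" for Q
    proof -
      have "Q \<in> \<O>" "Q \<inter> S \<noteq> {}" using that unfolding \<O>1_def by blast+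
      then have "\<exists>x\<in>A \<inter> S. Q \<inter> S = {x} \<and> Q \<subseteq> U x"
        using O3 by (iprover dest: bspec)
      then obtain x where x: "x \<in> A \<inter> S" "Q \<inter> S = {x}" "Q \<subseteq> U x" by (elim bexE conjE)
      have "x \<in> T" using AT x(1) by (rule subsetD)
      moreover have "x \<in> Q" using x(2) by blast
      ultimately show ?thesis using x(3) by blast
    qed
    have QR: "\<exists>N\<in>\<N> \<union> R ` T. Q \<simeq> N" if "Q \<in> \<O>1" for Q
    proof -
      from top[OF that] obtain x where x: "x \<in> T" "x \<in> Q" "Q \<subseteq> U x" by (elim bexE conjE)
      have "Q \<preceq> R x" using fits_trans[OF fits_subset[OF x(3)] R(1)[OF x(1)]] .
      moreover have "R x \<preceq> Q" using RO[OF x(1) _ x(2)] openO that unfolding \<O>1_def by blast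
      ultimately show ?thesis using x(1) by blast
    qed
    have O1: "disjoint \<O>1" "\<And>Q. Q \<in> \<O>1 \<Longrightarrow> openin X Q \<and> Q \<noteq> {}"
      using O(1) openO unfolding \<O>1_def by (auto intro: pairwise_subset)
    have AB: "A = B \<union> \<Union>\<O>1" using O(2) unfolding B_def \<O>1_def by blast
    have BO1: "B \<inter> Q = {}" if "Q \<in> \<O>1" for Q
    proof -
      have "P \<inter> Q = {}" if "P \<in> \<O>" "P \<inter> S = {}" for P
        using that \<open>Q \<in> \<O>1\<close> O(1) unfolding \<O>1_def by (metis (mono_tags, lifting) disjointD mem_Collect_eq)
      then show ?thesis unfolding B_def by blast
    qed
    have openB: "openin X B" unfolding B_def using openO by (intro openin_Union) blast
    have BS: "B \<inter> S = {}" unfolding B_def by blast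
    show ?thesis
    proof (cases "B \<inter> M = {}")
      case False
      have "decomposes \<N> B" using dec[OF openB] BS False unfolding S_def by blast
      then obtain \<P> where P: "disjoint \<P>" "\<Union>\<P> = B" "\<And>P. P \<in> \<P> \<Longrightarrow> openin X P \<and> P \<noteq> {} \<and> (\<exists>N\<in>\<N>. P \<simeq> N)"
        unfolding decomposes_def by blast
      have "disjoint (\<P> \<union> \<O>1)"
      proof (rule disjoint_union[OF P(1) O1(1)])
        show "\<Union>\<P> \<inter> \<Union>\<O>1 = {}" unfolding P(2) using BO1 by blast
      qed
      moreover have "\<Union>(\<P> \<union> \<O>1) = A" using AB P(2) by simp
      moreover have "openin X Q \<and> Q \<noteq> {} \<and> (\<exists>N\<in>\<N> \<union> R ` T. Q \<simeq> N)" if "Q \<in> \<P> \<union> \<O>1" for Q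
      proof (cases "Q \<in> \<O>1")
        case True
        then show ?thesis using O1(2) QR by simp
      next
        case False
        then show ?thesis using P(3)[of Q] that by blast
      qed
      ultimately show ?thesis unfolding decomposes_def by (intro exI[of _ "\<P> \<union> \<O>1"]) simp
    next
      case True
      have "\<O>1 \<noteq> {}" using A(3) AB True by blast
      then obtain Q0 where Q0: "Q0 \<in> \<O>1" by blast
      then obtain x where x: "x \<in> T" "x \<in> Q0" "Q0 \<subseteq> U x" using top by blast
      let ?P = "B \<union> Q0"
      let ?z = "rep (local_type \<N> x)"
      have z: "?z \<in> T" "local_type \<N> ?z = local_type \<N> x" "?z \<in> R x"
        using rep[OF x(1)] U unfolding R_def by blast+
      have "absorbs ?z B"
        using M openB True z(1) SM unfolding absorbing_def T_def by blast
      then obtain W where W: "openin X W" "closedin X W" "?z \<in> W" "B \<preceq> R x - W"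
        using R(2)[OF x(1)] z(3) unfolding absorbs_def by blast
      have "openin X (R x \<inter> W)" "?z \<in> R x \<inter> W" using R(2)[OF x(1)] W z by auto
      then have "U x \<preceq> R x \<inter> W" using Ufit[OF x(1) _ z(2)] z(1) unfolding T_def by blast
      then have QW: "Q0 \<preceq> R x \<inter> W" using fits_trans[OF fits_subset[OF x(3)]] by blast
      \<comment> \<open>The negligible part goes outside \<open>W\<close>, the piece around \<open>x\<close> inside.\<close>
      have "(\<Union>b\<in>UNIV. if b then B else Q0) \<preceq> (\<Union>b\<in>UNIV. if b then R x - W else R x \<inter> W)"
      proof (rule fits_sum)
        show "disjoint_family_on (\<lambda>b. if b then B else Q0) UNIV"
          using BO1[OF Q0] by (auto simp: disjoint_family_on_def)
        show "disjoint_family_on (\<lambda>b. if b then R x - W else R x \<inter> W) UNIV"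
          by (auto simp: disjoint_family_on_def)
      qed (use openB O1(2)[OF Q0] R(2)[OF x(1)] W QW in auto)
      then have "?P \<preceq> R x" by (rule fits_mono) (auto simp: UNIV_bool)
      moreover have "R x \<preceq> ?P" using RO[OF x(1) _ x(2)] O1(2)[OF Q0] fits_mono[of X "R x" Q0] by blast
      ultimately have P: "\<exists>N\<in>\<N> \<union> R ` T. ?P \<simeq> N" using x(1) by blast
      let ?\<P> = "insert ?P (\<O>1 - {Q0})"
      have "?P \<inter> Q = {}" if "Q \<in> \<O>1 - {Q0}" for Q
        using that BO1[of Q] O1(1) Q0 by (metis DiffD1 DiffD2 Int_Un_distrib2 disjointD insertCI sup_bot.left_neutral)
      moreover have "disjoint (\<O>1 - {Q0})" using O1(1) by (rule pairwise_subset) blast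
      ultimately have "disjoint ?\<P>" by (auto simp: disjoint_def pairwise_insert disjnt_def Int_commute)
      moreover have "\<Union>?\<P> = A" using AB Q0 by blast
      moreover have "openin X Q \<and> Q \<noteq> {} \<and> (\<exists>N\<in>\<N> \<union> R ` T. Q \<simeq> N)" if "Q \<in> ?\<P>" for Q
      proof (cases "Q = ?P")
        case True
        then show ?thesis using P openB O1(2)[OF Q0] by auto
      next
        case False
        then show ?thesis using that O1(2) QR by simp
      qed
      ultimately show ?thesis unfolding decomposes_def by (intro exI[of _ ?\<P>]) simp
    qed
  qed
  then show ?case using fin finR by (intro exI[of _ "\<N> \<union> R ` T"]) simp
qed

end

section \<open>Dickson's lemma for cardinals\<close>

text \<open>Repeatedly pass to a later index at which the least of the remaining values is attained.\<close>

lemma ordLeq_monotone_subsequence: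
  fixes f :: "nat \<Rightarrow> 'b rel"
  assumes "\<And>k. Well_order (f k)"
  shows "\<exists>s :: nat \<Rightarrow> nat. strict_mono s \<and> (\<forall>i j. i < j \<longrightarrow> f (s i) \<le>o f (s j))"
proof -
  have "\<exists>m>k. \<forall>j>k. f m \<le>o f j" for k
  proof -
    have "\<exists>r\<in>f ` {k<..}. \<forall>r'\<in>f ` {k<..}. r \<le>o r'"
      using assms by (intro exists_minim_Well_order) auto
    then show ?thesis by auto
  qed
  then obtain m where m: "\<And>k. m k > k" "\<And>k j. j > k \<Longrightarrow> f (m k) \<le>o f j" by metis
  define s where "s i = (m ^^ Suc i) 0" for i
  have s: "s (Suc i) = m (s i)" for i unfolding s_def by simp
  have mono: "strict_mono s" using m(1) s by (simp add: strict_mono_Suc_iff)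
  moreover have "f (s i) \<le>o f (s j)" if ij: "i < j" for i j
  proof (cases i)
    case 0
    have "s j > 0" using mono ij 0 strict_monoD[OF mono, of 0 j] by simp
    moreover have "s 0 = m 0" unfolding s_def by simp
    ultimately show ?thesis using m(2)[of 0] 0 by simp
  next
    case (Suc k)
    have "s j > s k" using strict_monoD[OF mono] ij Suc by simp
    then show ?thesis using m(2)[of "s k"] s Suc by simp
  qed
  ultimately show ?thesis by blast
qed

lemma ordLeq_dickson:
  fixes f :: "nat \<Rightarrow> 'c \<Rightarrow> 'b rel"
  assumes "finite I" "\<And>k c. Well_order (f k c)"
  shows "\<exists>s :: nat \<Rightarrow> nat. strict_mono s \<and> (\<forall>c\<in>I. \<forall>i j. i < j \<longrightarrow> f (s i) c \<le>o f (s j) c)"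
  using assms(1)
proof (induction I rule: finite_induct)
  case empty
  show ?case by (rule exI[of _ id]) (auto simp: strict_mono_def)
next
  case (insert a I)
  then obtain s :: "nat \<Rightarrow> nat" where s: "strict_mono s" "\<And>c i j. c \<in> I \<Longrightarrow> i < j \<Longrightarrow> f (s i) c \<le>o f (s j) c"
    by blast
  obtain t :: "nat \<Rightarrow> nat" where t: "strict_mono t" "\<And>i j. i < j \<Longrightarrow> f (s (t i)) a \<le>o f (s (t j)) a"
    using ordLeq_monotone_subsequence[of "\<lambda>k. f (s k) a"] assms(2) by blast
  have "strict_mono (s \<circ> t)" using s(1) t(1) by (rule strict_mono_o)
  moreover have "f ((s \<circ> t) i) c \<le>o f ((s \<circ> t) j) c" if "c \<in> insert a I" "i < j" for c i j
    using that s(2) t strict_monoD[OF t(1)] by (cases "c = a") auto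
  ultimately show ?case by blast
qed

section \<open>The chain of derivatives\<close>

text \<open>The Cantor--Bendixson derivatives of countable index, without ordinals: the limit rule takes
intersections of countable families. Their order type is recovered from \<open>derivatives_linear\<close>.\<close>

inductive_set derivatives :: "'a topology \<Rightarrow> 'a set set" for X where
  topspace: "topspace X \<in> derivatives X"
| derived: "S \<in> derivatives X \<Longrightarrow> derived X S \<in> derivatives X"
| limit: "(\<And>i :: nat. S i \<in> derivatives X) \<Longrightarrow> (\<Inter>i. S i) \<in> derivatives X"

lemma closedin_derivatives: "S \<in> derivatives X \<Longrightarrow> closedin X S"
  by (induction rule: derivatives.induct) (auto intro: closedin_derived)

lemma derivatives_subset: "S \<in> derivatives X \<Longrightarrow> S \<subseteq> topspace X"
  by (rule closedin_subset[OF closedin_derivatives])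

text \<open>The derivative is monotone, so nested inductions on the generation of \<open>L\<close> and of \<open>M\<close> suffice. In
particular the derivatives form a chain, in which \<open>derived X L\<close> comes immediately after \<open>L\<close>.\<close>

lemma derivatives_linear:
  assumes "L \<in> derivatives X" "M \<in> derivatives X"
  shows "L \<subseteq> M \<or> M \<subseteq> derived X L"
proof -
  have mono: "derived X S \<subseteq> derived X T" if "S \<subseteq> T" "T \<in> derivatives X" for S T
    using derived_mono[OF that(1) derivatives_subset[OF that(2)]] .
  show ?thesis
    using assms
  proof (induction L arbitrary: M rule: derivatives.induct)
    case topspace
    from topspace show ?case
    proof (induction M rule: derivatives.induct)
      case (derived S)
      then show ?case using mono[OF derivatives_subset derivatives.topspace] by blast
    next
      case (limit S)
      show ?case
      proof (cases "\<exists>i. S i \<subseteq> derived X (topspace X)")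
        case False
        then show ?thesis using limit.IH by blast
      qed blast
    qed simp
  next
    case (derived L)
    from derived.prems show ?case
    proof (induction M rule: derivatives.induct)
      case topspace
      then show ?case using derivatives_subset[OF derivatives.derived[OF derived.hyps(1)]] by blast
    next
      case (derived M')
      have "L \<subseteq> M' \<or> M' \<subseteq> derived X L" using derived.hyps(1) \<open>\<And>M. M \<in> derivatives X \<Longrightarrow> L \<subseteq> M \<or> M \<subseteq> derived X L\<close> by blast
      then show ?case
      proof
        assume "L \<subseteq> M'"
        then show ?thesis using mono derived.hyps(1) by blast
      next
        assume "M' \<subseteq> derived X L"
        then show ?thesis using mono derivatives.derived \<open>L \<in> derivatives X\<close> by blast
      qed
    next
      case (limit S)
      show ?case
      proof (cases "\<exists>i. S i \<subseteq> derived X (derived X L)")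
        case False
        then show ?thesis using limit.IH by blast
      qed blast
    qed
  next
    case (limit S)
    let ?L = "\<Inter>i. S i"
    have L: "?L \<in> derivatives X" using limit.hyps by (rule derivatives.limit)
    have IH: "S i \<subseteq> M \<or> M \<subseteq> derived X (S i)" if "M \<in> derivatives X" for i M
      using limit.IH that by blast
    from limit.prems show ?case
    proof (induction M rule: derivatives.induct)
      case topspace
      then show ?case using derivatives_subset[OF L] by blast
    next
      case (derived M)
      show ?case
      proof (cases "M \<subseteq> derived X ?L")
        case True
        then show ?thesis using derived_subset[of X M] by blast
      next
        case False
        then have LM: "?L \<subseteq> M" using derived.IH by blast
        show ?thesis
        proof (cases "\<exists>i. S i \<subseteq> M")
          case False
          then have "M \<subseteq> S i" for i using IH[OF derived.hyps] derived_subset[of X "S i"] by blast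
          then have "M = ?L" using LM by blast
          then show ?thesis by simp
        next
          case True
          then obtain i where i: "S i \<subseteq> M" by blast
          have D: "derived X M \<in> derivatives X" using derived.hyps by (rule derivatives.derived)
          show ?thesis
          proof (cases "\<exists>j. S j \<subseteq> derived X M")
            case True
            then show ?thesis by blast
          next
            case False
            then have "derived X M \<subseteq> derived X (S j)" for j using IH[OF D] by blast
            have "S i \<subseteq> S j" for j
            proof (rule ccontr)
              assume "\<not> S i \<subseteq> S j"
              then have "S j \<subseteq> derived X (S i)" using IH[OF limit.hyps, of i j] by blast
              also have "\<dots> \<subseteq> derived X M" using i mono derived.hyps by blast
              finally show False using False by blast
            qed
            then have "?L = S i" by blast
            then show ?thesis using \<open>derived X M \<subseteq> derived X (S i)\<close> by simp
          qed
        qed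
      qed
    next
      case (limit T)
      show ?case
      proof (cases "\<exists>i. T i \<subseteq> derived X ?L")
        case False
        then have "?L \<subseteq> T i" for i using limit.IH by blast
        then show ?thesis by blast
      qed blast
    qed
  qed
qed

lemma funpow_derived_in_derivatives: "S \<in> derivatives X \<Longrightarrow> (derived X ^^ n) S \<in> derivatives X"
  by (induction n) (auto intro: derivatives.derived)

section \<open>Bad sequences\<close>

context omega1_P_space
begin

definition bad :: "(nat \<Rightarrow> 'a set) \<Rightarrow> bool" where
  "bad A \<longleftrightarrow> (\<forall>k. openin X (A k)) \<and> (\<forall>i j. i < j \<longrightarrow> \<not> A i \<preceq> A j)"

text \<open>The statement carried through the induction along the derivatives. Over the empty set it says that there is
no bad sequence at all.\<close>

definition unavoidable :: "'a set \<Rightarrow> bool" where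
  "unavoidable M \<longleftrightarrow> (\<forall>A k. bad A \<longrightarrow> A k \<inter> M \<noteq> {})"

text \<open>Count the pieces of each kind. Cardinals are well-ordered, so for two terms every count of the earlier one
is at most the corresponding count of the later one, and matching the pieces accordingly yields an
embedding.\<close>

lemma decomposed_not_bad:
  assumes fin: "finite \<N>" and dec: "\<And>k. decomposes \<N> (A k)"
  shows "\<not> bad A"
proof
  assume bad: "bad A"
  have "\<forall>k. \<exists>\<P>. disjoint \<P> \<and> \<Union>\<P> = A k \<and> (\<forall>P\<in>\<P>. openin X P \<and> P \<noteq> {} \<and> (\<exists>N\<in>\<N>. P \<simeq> N))"
    using dec unfolding decomposes_def by blast
  from choice[OF this] obtain \<P> where P: "\<And>k. disjoint (\<P> k)" "\<And>k. \<Union>(\<P> k) = A k"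
      "\<And>k P. P \<in> \<P> k \<Longrightarrow> openin X P" and N: "\<And>k P. P \<in> \<P> k \<Longrightarrow> \<exists>N\<in>\<N>. P \<simeq> N" by blast
  define \<nu> where "\<nu> P = (SOME N. N \<in> \<N> \<and> P \<simeq> N)" for P
  have \<nu>: "\<nu> P \<in> \<N> \<and> P \<simeq> \<nu> P" if "P \<in> \<P> k" for k P
    unfolding \<nu>_def by (rule someI_ex) (use N[OF that] in blast)
  define cls where "cls k N = {P\<in>\<P> k. \<nu> P = N}" for k N
  obtain s :: "nat \<Rightarrow> nat" where s: "strict_mono s"
      "\<And>N i j. N \<in> \<N> \<Longrightarrow> i < j \<Longrightarrow> |cls (s i) N| \<le>o |cls (s j) N|"
    using ordLeq_dickson[OF fin, of "\<lambda>k N. card_of (cls k N)"] card_of_Well_order by blast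
  \<comment> \<open>\<open>\<phi>\<close> will match pieces of equal kind, each fitting into its partner through their common block.\<close>
  let ?i = "s 0" let ?j = "s 1"
  have "\<forall>N\<in>\<N>. \<exists>g. inj_on g (cls ?i N) \<and> g ` cls ?i N \<subseteq> cls ?j N"
    using s(2)[of _ 0 1] unfolding card_of_ordLeq[symmetric] by simp
  from bchoice[OF this] obtain g where
    g: "\<And>N. N \<in> \<N> \<Longrightarrow> inj_on (g N) (cls ?i N) \<and> g N ` cls ?i N \<subseteq> cls ?j N" by blast
  define \<phi> where "\<phi> P = g (\<nu> P) P" for P
  have \<phi>: "\<phi> P \<in> cls ?j (\<nu> P)" if "P \<in> \<P> ?i" for P
  proof -
    have "P \<in> cls ?i (\<nu> P)" using that unfolding cls_def by simp
    then show ?thesis using g \<nu>[OF that] unfolding \<phi>_def by blast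
  qed
  have inj: "P = Q" if PQ: "P \<in> \<P> ?i" "Q \<in> \<P> ?i" "\<phi> P = \<phi> Q" for P Q
  proof -
    have eq: "\<nu> P = \<nu> Q" using \<phi>[OF PQ(1)] \<phi>[OF PQ(2)] PQ(3) unfolding cls_def by simp
    have "inj_on (g (\<nu> P)) (cls ?i (\<nu> P))" using g \<nu>[OF PQ(1)] by blast
    moreover have "P \<in> cls ?i (\<nu> P)" "Q \<in> cls ?i (\<nu> P)" using PQ eq unfolding cls_def by simp_all
    moreover have "g (\<nu> P) P = g (\<nu> P) Q" using PQ(3) eq unfolding \<phi>_def by simp
    ultimately show ?thesis by (meson inj_onD)
  qed
  have "(\<Union>P\<in>\<P> ?i. P) \<preceq> (\<Union>P\<in>\<P> ?i. \<phi> P)"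
  proof (rule fits_sum)
    show "disjoint_family_on (\<lambda>P. P) (\<P> ?i)"
      using P(1)[of ?i] unfolding disjoint_family_on_def by (meson disjointD)
    show "disjoint_family_on \<phi> (\<P> ?i)"
      unfolding disjoint_family_on_def
    proof (intro ballI impI)
      fix P Q assume PQ: "P \<in> \<P> ?i" "Q \<in> \<P> ?i" "P \<noteq> Q"
      then have "\<phi> P \<noteq> \<phi> Q" using inj by blast
      then show "\<phi> P \<inter> \<phi> Q = {}"
        using \<phi>[OF PQ(1)] \<phi>[OF PQ(2)] P(1)[of ?j] unfolding cls_def
        by (metis (mono_tags, lifting) disjointD mem_Collect_eq)
    qed
    show "P \<preceq> \<phi> P" if "P \<in> \<P> ?i" for P
    proof -
      have "\<phi> P \<in> \<P> ?j" "\<nu> (\<phi> P) = \<nu> P" using \<phi>[OF that] unfolding cls_def by auto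
      then show ?thesis using \<nu>[OF that] \<nu>[of "\<phi> P" ?j] fits_trans by metis
    qed
    show "openin X (\<phi> P)" if "P \<in> \<P> ?i" for P
      using \<phi>[OF that] P(3) unfolding cls_def by blast
  qed (use P(3) in blast)
  moreover have "A ?i \<subseteq> (\<Union>P\<in>\<P> ?i. P)" using P(2)[of ?i] by simp
  moreover have "(\<Union>P\<in>\<P> ?i. \<phi> P) \<subseteq> A ?j"
    using \<phi> P(2)[of ?j] unfolding cls_def by blast
  ultimately have "A ?i \<preceq> A ?j" by (rule fits_mono)
  moreover have "?i < ?j" using s(1) by (simp add: strict_monoD)
  ultimately show False using bad unfolding bad_def by blast
qed

text \<open>If a term misses the derivative of level \<open>n\<close>, then no later term reaches level \<open>2 * n\<close>, as the former would
embed in it. All later terms meet \<open>M\<close>, hence decompose into finitely many kinds of blocks.\<close>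

lemma unavoidable_funpow_derived:
  assumes M: "absorbing M" "unavoidable M"
  shows "unavoidable ((derived X ^^ n) M)"
  unfolding unavoidable_def
proof (intro allI impI notI)
  fix A k assume bad: "bad A" and k: "A k \<inter> (derived X ^^ n) M = {}"
  define B where "B i = A (k + 1 + i)" for i
  have B: "bad B" using bad unfolding bad_def B_def by simp
  obtain \<N> where fin: "finite \<N>" and dec: "\<And>A. openin X A \<Longrightarrow> A \<inter> (derived X ^^ (2 * n)) M = {} \<Longrightarrow>
      A \<inter> M \<noteq> {} \<Longrightarrow> decomposes \<N> A"
    using decomposition[OF M(1), of "2 * n"] by blast
  have "decomposes \<N> (B i)" for i
  proof (rule dec)
    show "openin X (B i)" using B unfolding bad_def by blast
    show "B i \<inter> M \<noteq> {}" using B M(2) unfolding unavoidable_def by blast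
    show "B i \<inter> (derived X ^^ (2 * n)) M = {}"
    proof (rule ccontr)
      assume "B i \<inter> (derived X ^^ (2 * n)) M \<noteq> {}"
      then obtain y where y: "y \<in> (derived X ^^ (2 * n)) M" "y \<in> B i" by blast
      have op: "openin X (A k)" "openin X (B i)" using bad B unfolding bad_def by blast+
      have "A k \<preceq> B i" by (rule fits_near_derived[OF M(1) op(1) k y(1) op(2) y(2)])
      moreover have "k < k + 1 + i" by simp
      ultimately show False using bad unfolding bad_def B_def by blast
    qed
  qed
  then show False using decomposed_not_bad[OF fin] B by blast
qed

section \<open>Limits of derivatives\<close>

lemma infinite_near_limit:
  assumes K: "K \<subseteq> topspace X" and B: "openin X B" "B \<inter> derived X K \<noteq> {}"
  shows "infinite (B \<inter> K)"
proof
  assume "finite (B \<inter> K)"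
  from B(2) obtain z where z: "z \<in> B" "z \<in> derived X K" by blast
  have lim: "\<exists>z'\<in>K. z' \<in> U \<and> z' \<noteq> z" if "openin X U" "z \<in> U" for U
    using z(2) that unfolding derived_iff[OF K] by blast
  have "closedin X (B \<inter> K - {z})"
    using \<open>finite (B \<inter> K)\<close> K by (intro closedin_countable countable_finite) auto
  with B(1) have "openin X (B - (B \<inter> K - {z}))" by (rule openin_diff)
  from lim[OF this] z(1) show False by blast
qed

lemma separated_neighbourhoods:
  assumes B: "openin X B" and K: "\<And>i :: nat. infinite (B \<inter> K i)"
  shows "\<exists>G. disjoint_family_on G UNIV \<and> (\<forall>i :: nat. openin X (G i) \<and> G i \<subseteq> B \<and> G i \<inter> K i \<noteq> {})"
proof -
  have "\<exists>y. \<forall>i :: nat. y i \<in> B \<inter> K i - y ` {..<i}"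
  proof (rule dependent_wellorder_choice)
    fix i and f :: "nat \<Rightarrow> 'a"
    have "infinite (B \<inter> K i - f ` {..<i})" using K by (intro Diff_infinite_finite) auto
    then have "B \<inter> K i - f ` {..<i} \<noteq> {}" by (rule infinite_imp_nonempty)
    then show "\<exists>r. r \<in> B \<inter> K i - f ` {..<i}" by blast
  next
    fix f g :: "nat \<Rightarrow> 'a" and i :: nat and r
    assume "\<And>j. j < i \<Longrightarrow> f j = g j"
    then have "f ` {..<i} = g ` {..<i}" by (intro image_cong) auto
    then show "(r \<in> B \<inter> K i - f ` {..<i}) = (r \<in> B \<inter> K i - g ` {..<i})" by simp
  qed
  then obtain y where y: "\<And>i :: nat. y i \<in> B \<inter> K i" "\<And>i. y i \<notin> y ` {..<i}" by blast
  have inj: "y i \<noteq> y j" if "i < j" for i j using y(2)[of j] that by (metis imageI lessThan_iff)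
  have "inj y"
  proof (rule injI, rule ccontr)
    fix i j assume "y i = y j" "i \<noteq> j"
    then show False using inj[of i j] inj[of j i] by (metis neqE)
  qed
  have yt: "range y \<subseteq> topspace X" using y(1) B openin_subset by blast
  have "\<forall>i. \<exists>C. openin X C \<and> closedin X C \<and> y i \<in> C \<and> C \<subseteq> B - y ` (- {i})"
  proof
    fix i
    have "closedin X (y ` (- {i}))" using yt by (intro closedin_countable) auto
    then have "openin X (B - y ` (- {i}))" using B by (intro openin_diff)
    moreover have "y i \<in> B - y ` (- {i})" using y(1)[of i] \<open>inj y\<close> by (simp add: inj_image_mem_iff)
    ultimately show "\<exists>C. openin X C \<and> closedin X C \<and> y i \<in> C \<and> C \<subseteq> B - y ` (- {i})"
      by (rule clopen_nbhd)
  qed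
  from choice[OF this] obtain C where
    C: "\<And>i. openin X (C i) \<and> closedin X (C i) \<and> y i \<in> C i \<and> C i \<subseteq> B - y ` (- {i})" by blast
  define G where "G i = C i - (\<Union>j<i. C j)" for i :: nat
  have "disjoint_family_on G UNIV"
    unfolding disjoint_family_on_def
  proof (intro ballI impI)
    fix i j :: nat assume "i \<noteq> j"
    then have "i < j \<or> j < i" by (simp add: neq_iff)
    then show "G i \<inter> G j = {}" unfolding G_def by blast
  qed
  moreover have "openin X (G i)" for i
    unfolding G_def using C by (intro openin_diff closedin_countable_UN) auto
  moreover have "G i \<subseteq> B" for i using C[of i] unfolding G_def by blast
  moreover have "G i \<inter> K i \<noteq> {}" for i
  proof -
    have "y i \<notin> C j" if "j < i" for j
    proof -
      have "y i \<in> y ` (- {j})" using that by simp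
      then show ?thesis using C[of j] by blast
    qed
    then have "y i \<in> G i" using C[of i] unfolding G_def by blast
    then show ?thesis using y(1)[of i] by blast
  qed
  ultimately show ?thesis by (intro exI[of _ G] conjI allI)
qed

text \<open>An open set that misses the intersection of the \<open>S i\<close> is a disjoint union of countably many open parts,
the \<open>i\<close>-th of which misses \<open>S i\<close> and hence embeds in any open set that meets \<open>K i\<close>. The set \<open>B\<close> contains
infinitely many points of every \<open>K i\<close>, so it has room for disjoint neighbourhoods that host all the parts.\<close>

lemma fits_at_limit:
  fixes S K :: "nat \<Rightarrow> 'a set"
  assumes S: "\<And>i. closedin X (S i)" and K: "\<And>i. K i \<subseteq> topspace X"
    and fit: "\<And>i P V. openin X P \<Longrightarrow> P \<inter> S i = {} \<Longrightarrow> openin X V \<Longrightarrow> V \<inter> K i \<noteq> {} \<Longrightarrow> P \<preceq> V"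
    and cof: "\<And>i. \<exists>j. S j \<subseteq> derived X (K i)"
    and P: "openin X P" "P \<inter> (\<Inter>i. S i) = {}" and B: "openin X B" "\<And>i. B \<inter> S i \<noteq> {}"
  shows "P \<preceq> B"
proof -
  have inf: "infinite (B \<inter> K i)" for i
  proof (rule infinite_near_limit[OF K B(1)])
    show "B \<inter> derived X (K i) \<noteq> {}" using cof[of i] B(2) by blast
  qed
  obtain G where G1: "disjoint_family_on G UNIV"
    and G': "\<forall>i. openin X (G i) \<and> G i \<subseteq> B \<and> G i \<inter> K i \<noteq> {}"
    using separated_neighbourhoods[OF B(1), of K] inf by metis
  have G: "openin X (G i)" "G i \<subseteq> B" "G i \<inter> K i \<noteq> {}" for i using G' by simp_all
  let ?C = "range (\<lambda>i. P - S i)"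
  have "\<exists>\<O>. disjoint \<O> \<and> \<Union>\<O> = \<Union>?C \<and>
     (\<forall>Q\<in>\<O>. openin X Q \<and> closedin X Q \<and> Q \<noteq> {} \<and> (\<exists>C\<in>?C. Q \<subseteq> C))"
    using P(1) S by (intro disjoint_refinement) auto
  then obtain \<O> where O: "disjoint \<O>" "\<Union>\<O> = \<Union>?C" and
    O': "\<forall>Q\<in>\<O>. openin X Q \<and> closedin X Q \<and> Q \<noteq> {} \<and> (\<exists>C\<in>?C. Q \<subseteq> C)"
    by (elim exE conjE)
  have O3: "openin X Q" "\<exists>i. Q \<inter> S i = {}" if "Q \<in> \<O>" for Q
    using O'[rule_format, OF that] by (simp, blast)
  have "\<Union>?C = P - (\<Inter>i. S i)" by auto
  then have PO: "\<Union>\<O> = P" using O(2) P(2) by (simp add: Diff_triv)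
  define ix where "ix Q = (LEAST i. Q \<inter> S i = {})" for Q
  have ix: "Q \<inter> S (ix Q) = {}" if "Q \<in> \<O>" for Q
  proof -
    from O3(2)[OF that] obtain i where "Q \<inter> S i = {}" by blast
    then show ?thesis unfolding ix_def by (rule LeastI)
  qed
  define P' where "P' i = \<Union>{Q\<in>\<O>. ix Q = i}" for i
  have P': "openin X (P' i)" "P' i \<inter> S i = {}" for i
    unfolding P'_def using O3(1) ix by (auto intro!: openin_Union)
  have "(\<Union>i. P' i) \<preceq> (\<Union>i. G i)"
  proof (rule fits_sum)
    show "disjoint_family_on P' UNIV"
      unfolding disjoint_family_on_def
    proof (intro ballI impI)
      fix i j :: nat assume ij: "i \<noteq> j"
      have "Q \<inter> R = {}" if "Q \<in> \<O>" "R \<in> \<O>" "ix Q = i" "ix R = j" for Q R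
        using that ij O(1) by (metis disjointD)
      then show "P' i \<inter> P' j = {}" unfolding P'_def by blast
    qed
    show "P' i \<preceq> G i" for i by (rule fit[OF P' G(1,3)])
  qed (use P' G1 G in simp_all)
  moreover have "P \<subseteq> (\<Union>i. P' i)" using PO unfolding P'_def by blast
  moreover have "(\<Union>i. G i) \<subseteq> B" using G(2) by blast
  ultimately show ?thesis by (rule fits_mono)
qed

text \<open>In the limit case let \<open>S i\<close> be the \<open>n i\<close>-th derivative of \<open>M i\<close> and \<open>K i\<close> its \<open>2 * n i\<close>-th. If some \<open>S j\<close> lies
strictly below each \<open>K i\<close>, then \<open>fits_near_derived\<close> and \<open>fits_at_limit\<close> show that the intersection is
itself absorbing and unavoidable. If not, then for some \<open>i\<close> every \<open>S j\<close> contains \<open>K i\<close>, and the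
intersection is one of the finitely many derivatives between \<open>S i\<close> and \<open>K i\<close>.\<close>

lemma derivatives_reduce:
  assumes "L \<in> derivatives X"
  shows "\<exists>M n. absorbing M \<and> unavoidable M \<and> L = (derived X ^^ n) M"
  using assms
proof (induction L rule: derivatives.induct)
  case topspace
  have "absorbing (topspace X)"
  proof -
    have "absorbs y P" if "openin X P" "P \<inter> topspace X = {}" for y P
    proof -
      have "P = {}" using that openin_subset by blast
      then show ?thesis by (intro absorbsI) (blast intro: fits_subset)
    qed
    then show ?thesis unfolding absorbing_def by blast
  qed
  moreover have "unavoidable (topspace X)"
    unfolding unavoidable_def
  proof (intro allI impI notI)
    fix A k assume bad: "bad A" and "A k \<inter> topspace X = {}"
    then have "A k = {}" unfolding bad_def by (metis inf.absorb1 openin_subset)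
    then have "A k \<preceq> A (Suc k)" by (intro fits_subset) simp
    then show False using bad unfolding bad_def by blast
  qed
  ultimately show ?case by (intro exI[of _ "topspace X"] exI[of _ 0]) simp
next
  case (derived S)
  then obtain M n where "absorbing M" "unavoidable M" "S = (derived X ^^ n) M" by blast
  then show ?case by (intro exI[of _ M] exI[of _ "Suc n"]) simp
next
  case (limit S)
  from limit.IH have "\<forall>i. \<exists>Mn. absorbing (fst Mn) \<and> unavoidable (fst Mn) \<and> S i = (derived X ^^ snd Mn) (fst Mn)"
    by (metis fst_conv snd_conv)
  from choice[OF this] obtain Mn where
    Mn: "\<And>i. absorbing (fst (Mn i)) \<and> unavoidable (fst (Mn i)) \<and> S i = (derived X ^^ snd (Mn i)) (fst (Mn i))"
    by blast
  define M where "M i = fst (Mn i)" for i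
  define n where "n i = snd (Mn i)" for i
  have M: "absorbing (M i)" "unavoidable (M i)" "S i = (derived X ^^ n i) (M i)" for i
    using Mn unfolding M_def n_def by blast+
  define K where "K i = (derived X ^^ (2 * n i)) (M i)" for i
  let ?L = "\<Inter>i. S i"
  have KS: "K i = (derived X ^^ n i) (S i)" for i
    unfolding K_def M(3) by (simp add: mult_2 funpow_add)
  have Kd: "K i \<in> derivatives X" for i
    unfolding KS using limit.hyps by (rule funpow_derived_in_derivatives)
  have KS': "K i \<subseteq> S i" for i unfolding KS by (rule funpow_derived_subset)
  have Ld: "?L \<in> derivatives X" using limit.hyps by (rule derivatives.limit)
  show ?case
  proof (cases "\<forall>i. \<exists>j. S j \<subseteq> derived X (K i)")
    case True
    have LL: "P \<preceq> B" if "openin X P" "P \<inter> ?L = {}" "openin X B" "\<And>i. B \<inter> S i \<noteq> {}" for P B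
    proof (rule fits_at_limit[of S K P B])
      show "closedin X (S i)" for i using limit.hyps by (rule closedin_derivatives)
      show "K i \<subseteq> topspace X" for i using Kd by (rule derivatives_subset)
      fix i Q V assume Q: "openin X Q" "Q \<inter> S i = {}" and V: "openin X V" "V \<inter> K i \<noteq> {}"
      then obtain y where "y \<in> V" "y \<in> K i" by blast
      then show "Q \<preceq> V"
        using fits_near_derived[OF M(1) Q(1) _ _ V(1)] Q(2) unfolding M(3) K_def by blast
    qed (use that True in blast)+
    have "absorbing ?L"
      unfolding absorbing_def
    proof (intro conjI allI impI)
      show "closedin X ?L" using Ld by (rule closedin_derivatives)
      fix P y assume P: "openin X P \<and> P \<inter> ?L = {} \<and> y \<in> ?L"
      show "absorbs y P"
      proof (rule absorbsI)
        fix V assume V: "openin X V" "y \<in> V"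
        have St: "S i \<subseteq> topspace X" for i using limit.hyps by (rule derivatives_subset)
        have "\<exists>w\<in>S i. w \<in> V \<and> w \<noteq> y" for i
        proof -
          obtain j where "S j \<subseteq> derived X (K i)" using True by blast
          also have "\<dots> \<subseteq> derived X (S i)" using KS' St by (rule derived_mono)
          finally have "y \<in> derived X (S i)" using P by blast
          then show ?thesis using V unfolding derived_iff[OF St] by blast
        qed
        then obtain w where w: "\<And>i. w i \<in> S i" "\<And>i. w i \<in> V" "\<And>i. w i \<noteq> y" by metis
        \<comment> \<open>A neighbourhood \<open>W\<close> of \<open>y\<close> without any \<open>w i\<close> leaves \<open>V - W\<close> meeting every \<open>S i\<close>.\<close>
        have wt: "range w \<subseteq> topspace X" using w(1) St by blast
        have "closedin X (range w)" using wt by (intro closedin_countable) auto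
        then have "openin X (topspace X - range w)" by blast
        moreover have "y \<in> topspace X - range w" using w(3) V openin_subset by fastforce
        ultimately obtain W where W: "openin X W" "closedin X W" "y \<in> W" "W \<subseteq> topspace X - range w"
          using clopen_nbhd by blast
        have "P \<preceq> V - W"
        proof (rule LL)
          show "openin X (V - W)" using V W by (intro openin_diff)
          show "(V - W) \<inter> S i \<noteq> {}" for i using w(1,2)[of i] W(4) by blast
        qed (use P in blast)+
        then show "\<exists>W. openin X W \<and> y \<in> W \<and> P \<preceq> V - W" using W by blast
      qed
    qed
    moreover have "unavoidable ?L"
      unfolding unavoidable_def
    proof (intro allI impI notI)
      fix A k assume bad: "bad A" and k: "A k \<inter> ?L = {}"
      have "unavoidable (S i)" for i
        using unavoidable_funpow_derived[OF M(1,2)] M(3) by simp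
      then have "A (Suc k) \<inter> S i \<noteq> {}" for i using bad unfolding unavoidable_def by blast
      then have "A k \<preceq> A (Suc k)" using LL[OF _ k] bad unfolding bad_def by blast
      then show False using bad unfolding bad_def by blast
    qed
    ultimately show ?thesis by (intro exI[of _ ?L] exI[of _ 0]) simp
  next
    case False
    then obtain i where i: "\<And>j. \<not> S j \<subseteq> derived X (K i)" by blast
    have "\<exists>p. ?L = (derived X ^^ p) (S i)"
    proof (rule ccontr)
      assume no: "\<not> ?thesis"
      have below: "?L \<subseteq> (derived X ^^ p) (S i)" for p
      proof (induction p)
        case (Suc p)
        have "(derived X ^^ p) (S i) \<in> derivatives X"
          using limit.hyps by (rule funpow_derived_in_derivatives)
        then have "(derived X ^^ p) (S i) \<subseteq> ?L \<or> ?L \<subseteq> derived X ((derived X ^^ p) (S i))"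
          using Ld by (rule derivatives_linear)
        then show ?case using Suc no by auto
      qed auto
      have "K i \<subseteq> S j" for j using derivatives_linear[OF Kd limit.hyps] i by blast
      then have "K i \<subseteq> ?L" by blast
      then have "?L = (derived X ^^ n i) (S i)" using below[of "n i"] KS by blast
      then show False using no by blast
    qed
    then obtain p where "?L = (derived X ^^ p) (S i)" by blast
    then have "?L = (derived X ^^ (p + n i)) (M i)" using M(3)[of i] by (simp add: funpow_add)
    then show ?thesis using M(1,2) by blast
  qed
qed

theorem no_bad_sequence:
  assumes "{} \<in> derivatives X"
  shows "\<not> bad A"
proof
  assume bad: "bad A"
  from derivatives_reduce[OF assms] obtain M n
    where M: "absorbing M" "unavoidable M" "{} = (derived X ^^ n) M" by (elim exE conjE)
  have "unavoidable {}" using unavoidable_funpow_derived[OF M(1,2), of n] M(3) by simp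
  then show False using bad unfolding unavoidable_def by blast
qed

end

section \<open>The topological sum of a sequence of spaces\<close>

text \<open>Interpolate open and closed sets alternately between \<open>x\<close> and \<open>U\<close>. The intersection of the resulting
sequence is closed, and it is open in a P-space.\<close>

lemma clopen_neighbourhood_regular_P_space:
  assumes reg: "regular_space X" and P: "P_space X" and U: "openin X U" "x \<in> U"
  shows "\<exists>K. openin X K \<and> closedin X K \<and> x \<in> K \<and> K \<subseteq> U"
proof -
  have step: "\<exists>V. openin X V \<and> x \<in> V \<and> V \<subseteq> U \<and> (\<exists>C. closedin X C \<and> V \<subseteq> C \<and> C \<subseteq> U)"
    if "openin X U" "x \<in> U" for U
    using reg that unfolding neighbourhood_base_of_closedin[symmetric] neighbourhood_base_of
    by (meson order_trans)
  have "\<exists>V. \<forall>n :: nat. (openin X (V n) \<and> x \<in> V n \<and> V n \<subseteq> U) \<and>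
      (V (Suc n) \<subseteq> V n \<and> (\<exists>C. closedin X C \<and> V (Suc n) \<subseteq> C \<and> C \<subseteq> V n))"
  proof (rule dependent_nat_choice)
    show "\<exists>V. openin X V \<and> x \<in> V \<and> V \<subseteq> U" using U by blast
    fix V and n :: nat assume V: "openin X V \<and> x \<in> V \<and> V \<subseteq> U"
    then obtain V' where "openin X V' \<and> x \<in> V' \<and> V' \<subseteq> V \<and> (\<exists>C. closedin X C \<and> V' \<subseteq> C \<and> C \<subseteq> V)"
      using step[of V] by blast
    then show "\<exists>V'. (openin X V' \<and> x \<in> V' \<and> V' \<subseteq> U) \<and> (V' \<subseteq> V \<and> (\<exists>C. closedin X C \<and> V' \<subseteq> C \<and> C \<subseteq> V))"
      using V by (intro exI[of _ V']) auto
  qed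
  then obtain V where V': "\<forall>n :: nat. (openin X (V n) \<and> x \<in> V n \<and> V n \<subseteq> U) \<and>
      (V (Suc n) \<subseteq> V n \<and> (\<exists>C. closedin X C \<and> V (Suc n) \<subseteq> C \<and> C \<subseteq> V n))" by (rule exE)
  have V: "openin X (V n) \<and> x \<in> V n \<and> V n \<subseteq> U" for n using V' by simp
  have VC: "\<forall>n. \<exists>C. closedin X C \<and> V (Suc n) \<subseteq> C \<and> C \<subseteq> V n" using V' by simp
  from choice[OF VC] obtain C where C: "\<And>n. closedin X (C n) \<and> V (Suc n) \<subseteq> C n \<and> C n \<subseteq> V n" by blast
  have eq: "(\<Inter>n. V n) = (\<Inter>n. C n)"
  proof (intro equalityI subsetI INT_I)
    fix z n assume "z \<in> (\<Inter>n. V n)"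
    then have "z \<in> V (Suc n)" by blast
    then show "z \<in> C n" using C by blast
  next
    fix z n assume "z \<in> (\<Inter>n. C n)"
    then have "z \<in> C n" by blast
    then show "z \<in> V n" using C by blast
  qed
  have "gdelta_in X (\<Inter>n. V n)"
  proof -
    have "(\<Inter>n. V n) \<subseteq> topspace X" using V[of 0] openin_subset by blast
    moreover have "(countable intersection_of openin X) (\<Inter>n. V n)"
      unfolding intersection_of_def using V by (intro exI[of _ "range V"]) auto
    ultimately show ?thesis unfolding gdelta_in_alt by blast
  qed
  then have "openin X (\<Inter>n. V n)" using P unfolding P_space_def by blast
  moreover have "closedin X (\<Inter>n. V n)" unfolding eq using C by (intro closedin_INT) auto
  moreover have "x \<in> (\<Inter>n. V n)" "(\<Inter>n. V n) \<subseteq> U" using V by blast+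
  ultimately show ?thesis by blast
qed

lemma omega1_P_space_sum:
  fixes Y :: "nat \<Rightarrow> 'a topology"
  assumes "\<And>k. omega1_P_space (Y k) (\<B> k)"
  shows "omega1_P_space (sum_topology Y UNIV) (\<Union>k. (\<lambda>B. {k} \<times> B) ` \<B> k)" (is "omega1_P_space ?Z ?B")
proof
  note Y = assms[unfolded omega1_P_space_def]
  have slice: "openin (Y k) {x. (k, x) \<in> U}" if "openin ?Z U" for U k
    using that unfolding openin_sum_topology by blast
  have slab: "openin ?Z ({k} \<times> U)" if "openin (Y k) U" for U k
  proof -
    have "{x. (i, x) \<in> {k} \<times> U} = (if i = k then U else {})" for i by auto
    then show ?thesis using that openin_subset[OF that] unfolding openin_sum_topology by auto
  qed
  have slabc: "closedin ?Z ({k} \<times> U)" if "closedin (Y k) U" for U k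
  proof -
    have "{x. (i, x) \<in> {k} \<times> U} = (if i = k then U else {})" for i by auto
    then show ?thesis using that closedin_subset[OF that] unfolding closedin_sum_topology by auto
  qed
  show "t1_space ?Z"
    unfolding t1_space_closedin_singleton
  proof
    fix z assume "z \<in> topspace ?Z"
    then have "snd z \<in> topspace (Y (fst z))" by auto
    then have "closedin (Y (fst z)) {snd z}" using Y unfolding t1_space_closedin_singleton by blast
    then have "closedin ?Z ({fst z} \<times> {snd z})" by (rule slabc)
    then show "closedin ?Z {z}" by simp
  qed
  show "P_space ?Z"
    unfolding P_space_def
  proof (intro allI impI)
    fix S assume "gdelta_in ?Z S"
    then obtain \<U> where S: "S \<subseteq> topspace ?Z" and U: "countable \<U>" "\<And>U. U \<in> \<U> \<Longrightarrow> openin ?Z U" "\<Inter>\<U> = S"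
      unfolding gdelta_in_alt intersection_of_def by auto
    have "gdelta_in (Y k) {x. (k, x) \<in> S}" for k
      unfolding gdelta_in_alt intersection_of_def
    proof (intro conjI exI[of _ "(\<lambda>U. {x. (k, x) \<in> U}) ` \<U>"])
      show "\<Inter>((\<lambda>U. {x. (k, x) \<in> U}) ` \<U>) = {x. (k, x) \<in> S}" using U(3) by auto
    qed (use S U slice in auto)
    then have "openin (Y k) {x. (k, x) \<in> S}" for k using Y unfolding P_space_def by blast
    then show "openin ?Z S" using S unfolding openin_sum_topology by simp
  qed
  show "\<exists>K. openin ?Z K \<and> closedin ?Z K \<and> z \<in> K \<and> K \<subseteq> U" if U: "openin ?Z U" "z \<in> U" for U z
  proof -
    obtain k x where z: "z = (k, x)" by (rule prod.exhaust)
    have "openin (Y k) {x. (k, x) \<in> U}" "x \<in> {x. (k, x) \<in> U}" using slice U z by auto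
    then obtain K where "openin (Y k) K" "closedin (Y k) K" "x \<in> K" "K \<subseteq> {x. (k, x) \<in> U}"
      using Y[of k] by meson
    then show ?thesis using slab slabc z by (intro exI[of _ "{k} \<times> K"]) auto
  qed
  show "base_of ?Z ?B"
    unfolding base_of_def
  proof (intro conjI ballI allI impI)
    fix V assume "V \<in> ?B"
    then obtain k B where "B \<in> \<B> k" "V = {k} \<times> B" by blast
    moreover have "openin (Y k) B" using Y[of k] \<open>B \<in> \<B> k\<close> unfolding base_of_def by blast
    ultimately show "openin ?Z V" using slab by blast
  next
    fix U z assume U: "openin ?Z U \<and> z \<in> U"
    obtain k x where z: "z = (k, x)" by (rule prod.exhaust)
    have "openin (Y k) {x. (k, x) \<in> U}" "x \<in> {x. (k, x) \<in> U}" using slice U z by auto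
    then obtain B where "B \<in> \<B> k" "x \<in> B" "B \<subseteq> {x. (k, x) \<in> U}"
      using Y[of k] unfolding base_of_def by meson
    then show "\<exists>V\<in>?B. z \<in> V \<and> V \<subseteq> U" using z by (intro bexI[of _ "{k} \<times> B"]) auto
  qed
  have inf: "\<not> finite (Field (cardSuc natLeq))"
    using natLeq_Card_order Field_natLeq infinite_UNIV_nat cardSuc_finite by metis
  have card: "Card_order (cardSuc natLeq)" using natLeq_Card_order by (rule cardSuc_Card_order)
  have "|UNIV :: nat set| \<le>o natLeq" using card_of_nat ordIso_iff_ordLeq by blast
  then have "|UNIV :: nat set| \<le>o cardSuc natLeq"
    using cardSuc_greater[OF natLeq_Card_order] ordLess_imp_ordLeq ordLeq_transitive by blast
  moreover have "|(\<lambda>B. {k} \<times> B) ` \<B> k| \<le>o cardSuc natLeq" for k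
  proof -
    have "|\<B> k| \<le>o cardSuc natLeq" using Y[of k] by (elim conjE)
    then show ?thesis by (rule ordLeq_transitive[OF card_of_image])
  qed
  ultimately show "|?B| \<le>o cardSuc natLeq"
    by (intro card_of_UNION_ordLeq_infinite_Field[OF inf card]) simp_all
qed

lemma cb_step_in_derivatives:
  assumes r: "antisym r" and A: "countable A" "\<And>b. b \<in> A \<Longrightarrow> D b \<in> derivatives X"
  shows "cb_step X r A D \<in> derivatives X"
proof (cases "A = {}")
  case True
  then show ?thesis unfolding cb_step_def by (simp add: derivatives.topspace)
next
  case ne: False
  show ?thesis
  proof (cases "\<exists>m\<in>A. \<forall>b\<in>A. (b, m) \<in> r")
    case True
    then obtain m where m: "m \<in> A" "\<forall>b\<in>A. (b, m) \<in> r" by blast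
    show ?thesis unfolding cb_step_greatest[OF r m] using A(2)[OF m(1)] by (rule derivatives.derived)
  next
    case False
    have "cb_step X r A D = (\<Inter>b\<in>A. D b)" unfolding cb_step_def using ne False by (simp only: if_False)
    also have "\<dots> = (\<Inter>i :: nat. D (from_nat_into A i))"
      using range_from_nat_into[OF ne A(1)] by (metis image_image)
    also have "\<dots> \<in> derivatives X"
      using A(2) from_nat_into[OF ne] by (intro derivatives.limit) blast
    finally show ?thesis .
  qed
qed

text \<open>With a countable rank, all levels of the Cantor--Bendixson process are produced by the three rules for
\<open>derivatives\<close>, and the process ends with the empty set.\<close>

lemma empty_in_derivatives:
  assumes "scattered X" "countable (Field (cb_rank X))"
  shows "{} \<in> derivatives X"
proof -
  let ?r = "cb_rank X"
  have W: "Well_order ?r" using assms(1) by (rule Well_order_cb_rank)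
  then interpret wo: wo_rel ?r by (simp add: wo_rel_def)
  have level: "cb_level X ?r a \<in> derivatives X" for a
  proof (induction a rule: wo.well_order_induct)
    fix a assume IH: "\<forall>b. b \<noteq> a \<and> (b, a) \<in> ?r \<longrightarrow> cb_level X ?r b \<in> derivatives X"
    have "underS ?r a \<subseteq> Field ?r" using underS_Field[of _ ?r a] by blast
    then have "countable (underS ?r a)" using assms(2) by (rule countable_subset)
    then show "cb_level X ?r a \<in> derivatives X"
      unfolding cb_level_unfold[OF W, of X a] using IH
      by (intro cb_step_in_derivatives wo.ANTISYM) (auto simp: underS_def)
  qed
  have "cb_derivative X ?r \<in> derivatives X"
    unfolding cb_derivative_def using wo.ANTISYM assms(2) level by (rule cb_step_in_derivatives)
  then show ?thesis using cb_derivative_cb_rank[OF assms(1)] by simp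
qed

text \<open>A summand is open, so limit points within it are the same in the sum.\<close>

lemma derivatives_extend_to_sum:
  assumes "L \<in> derivatives (Y k)"
  shows "\<exists>M\<in>derivatives (sum_topology Y UNIV). \<forall>x. (k, x) \<in> M \<longleftrightarrow> x \<in> L"
  using assms
proof (induction L rule: derivatives.induct)
  case topspace
  show ?case by (rule bexI[OF _ derivatives.topspace]) simp
next
  case (derived S)
  let ?Z = "sum_topology Y UNIV"
  obtain M where M: "M \<in> derivatives ?Z" "\<And>x. (k, x) \<in> M \<longleftrightarrow> x \<in> S" using derived.IH by blast
  have St: "S \<subseteq> topspace (Y k)" using derived.hyps by (rule derivatives_subset)
  have Mt: "M \<subseteq> topspace ?Z" using M(1) by (rule derivatives_subset)
  have "(k, x) \<in> derived ?Z M \<longleftrightarrow> x \<in> derived (Y k) S" for x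
    unfolding derived_iff[OF St] derived_iff[OF Mt]
  proof (rule conj_cong[OF M(2)], rule iffI; intro allI impI)
    fix U assume H: "\<forall>U. openin ?Z U \<and> (k, x) \<in> U \<longrightarrow> (\<exists>z\<in>M. z \<in> U \<and> z \<noteq> (k, x))"
      and U: "openin (Y k) U \<and> x \<in> U"
    have "{x. (i, x) \<in> {k} \<times> U} = (if i = k then U else {})" for i by auto
    then have "openin ?Z ({k} \<times> U)"
      using U openin_subset[of "Y k" U] unfolding openin_sum_topology by auto
    then obtain z where "z \<in> M" "z \<in> {k} \<times> U" "z \<noteq> (k, x)" using H U by blast
    then show "\<exists>z\<in>S. z \<in> U \<and> z \<noteq> x" using M(2) by auto
  next
    fix U assume H: "\<forall>U. openin (Y k) U \<and> x \<in> U \<longrightarrow> (\<exists>z\<in>S. z \<in> U \<and> z \<noteq> x)"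
      and U: "openin ?Z U \<and> (k, x) \<in> U"
    then have "openin (Y k) {x. (k, x) \<in> U} \<and> x \<in> {x. (k, x) \<in> U}"
      unfolding openin_sum_topology by auto
    then obtain z where "z \<in> S" "z \<in> {x. (k, x) \<in> U}" "z \<noteq> x" using H by blast
    then show "\<exists>z\<in>M. z \<in> U \<and> z \<noteq> (k, x)" using M(2) by (intro bexI[of _ "(k, z)"]) auto
  qed
  then show ?case using derivatives.derived[OF M(1)] by blast
next
  case (limit S)
  then have "\<forall>i. \<exists>M. M \<in> derivatives (sum_topology Y UNIV) \<and> (\<forall>x. (k, x) \<in> M \<longleftrightarrow> x \<in> S i)" by blast
  from choice[OF this] obtain M where
    M: "\<And>i. M i \<in> derivatives (sum_topology Y UNIV)" "\<And>i x. (k, x) \<in> M i \<longleftrightarrow> x \<in> S i" by blast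
  have "(\<Inter>i. M i) \<in> derivatives (sum_topology Y UNIV)" using M(1) by (rule derivatives.limit)
  moreover have "\<forall>x. (k, x) \<in> (\<Inter>i. M i) \<longleftrightarrow> x \<in> (\<Inter>i. S i)" using M(2) by simp
  ultimately show ?case by (rule bexI[rotated])
qed

lemma fits_components_imp_embeds_in:
  assumes "fits (sum_topology Y UNIV) ({i} \<times> topspace (Y i)) ({j} \<times> topspace (Y j))"
  shows "Y i embeds_in Y j"
proof -
  let ?Z = "sum_topology Y UNIV" let ?A = "{i} \<times> topspace (Y i)"
  obtain f where f: "bicontinuous_on ?Z ?A f" "f ` ?A \<subseteq> {j} \<times> topspace (Y j)"
    using assms unfolding fits_def by blast
  define T where "T = snd ` f ` ?A"
  have T: "T \<subseteq> topspace (Y j)" "f ` ?A = Pair j ` T" using f(2) unfolding T_def by force+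
  have part: "subtopology (Y k) S homeomorphic_space subtopology ?Z (Pair k ` S)" if "S \<subseteq> topspace (Y k)" for k S
  proof -
    have "homeomorphic_map (Y k) (subtopology ?Z (Pair k ` topspace (Y k))) (Pair k)"
      using embedding_map_component_injection[of k UNIV Y] unfolding embedding_map_def by simp
    then have "homeomorphic_map (subtopology (Y k) S)
        (subtopology (subtopology ?Z (Pair k ` topspace (Y k))) (Pair k ` S)) (Pair k)"
      by (rule homeomorphic_map_subtopologies_alt) (use that in auto)
    moreover have "subtopology (subtopology ?Z (Pair k ` topspace (Y k))) (Pair k ` S) = subtopology ?Z (Pair k ` S)"
      using that by (simp add: subtopology_subtopology Int_absorb1 image_mono)
    ultimately show ?thesis by (metis homeomorphic_map_imp_homeomorphic_space)
  qed
  have "Y i homeomorphic_space subtopology ?Z (Pair i ` topspace (Y i))"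
    using part[of "topspace (Y i)" i] by simp
  also have "Pair i ` topspace (Y i) = ?A" by auto
  also have "subtopology ?Z ?A homeomorphic_space subtopology ?Z (f ` ?A)"
    by (rule bicontinuous_on_imp_homeomorphic[OF f(1)]) (use f(2) in auto)
  also have "f ` ?A = Pair j ` T" by (rule T(2))
  also have "subtopology ?Z (Pair j ` T) homeomorphic_space subtopology (Y j) T"
    using part[OF T(1)] by (rule homeomorphic_space_sym[THEN iffD1])
  finally show ?thesis using T(1) unfolding embeds_def by blast
qed

lemma embeds_in_trans:
  assumes "X embeds_in Y" "Y embeds_in Z"
  shows "X embeds_in Z"
proof -
  obtain S where S: "S \<subseteq> topspace Y" "X homeomorphic_space subtopology Y S"
    using assms(1) unfolding embeds_def by blast
  obtain T where T: "T \<subseteq> topspace Z" "Y homeomorphic_space subtopology Z T"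
    using assms(2) unfolding embeds_def by blast
  obtain h where h: "homeomorphic_map Y (subtopology Z T) h"
    using T(2) unfolding homeomorphic_space by blast
  have im: "h ` S \<subseteq> T" using h S(1) T(1) homeomorphic_imp_surjective_map[OF h] by auto
  have "homeomorphic_map (subtopology Y S) (subtopology (subtopology Z T) (h ` S)) h"
    by (rule homeomorphic_map_subtopologies[OF h]) (use S(1) T(1) im in auto)
  moreover have "subtopology (subtopology Z T) (h ` S) = subtopology Z (h ` S)"
    using im by (simp add: subtopology_subtopology Int_absorb1)
  ultimately have "subtopology Y S homeomorphic_space subtopology Z (h ` S)"
    by (metis homeomorphic_map_imp_homeomorphic_space)
  then have "X homeomorphic_space subtopology Z (h ` S)" using S(2) homeomorphic_space_trans by blast
  then show ?thesis using im T(1) unfolding embeds_def by blast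
qed

text \<open>For each \<open>k\<close> some derivative of the sum is disjoint from the \<open>k\<close>-th summand, and the intersection of these
countably many derivatives is an empty derivative, so \<open>no_bad_sequence\<close> applies to the sequence of
summands.\<close>

lemma embedding_in_sequence:
  fixes Y :: "nat \<Rightarrow> 'a topology"
  assumes "\<And>k. regular_space (Y k) \<and> t1_space (Y k)" "\<And>k. scattered (Y k)" "\<And>k. P_space (Y k)"
    and "\<And>k. weight (Y k) =o cardSuc natLeq" "\<And>k. countable (Field (cb_rank (Y k)))"
  shows "\<exists>i j. i < j \<and> Y i embeds_in Y j"
proof -
  let ?Z = "sum_topology Y UNIV"
  have "\<forall>k. \<exists>\<B>. base_of (Y k) \<B> \<and> |\<B>| \<le>o cardSuc natLeq"
    using weight(1) assms(4) ordIso_imp_ordLeq by metis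
  from choice[OF this] obtain \<B> where B: "\<And>k. base_of (Y k) (\<B> k) \<and> |\<B> k| \<le>o cardSuc natLeq" by blast
  have "omega1_P_space (Y k) (\<B> k)" for k
    using assms(1,3)[of k] B[of k] clopen_neighbourhood_regular_P_space[of "Y k"]
    by unfold_locales blast+
  then interpret Z: omega1_P_space ?Z "\<Union>k. (\<lambda>B. {k} \<times> B) ` \<B> k" by (rule omega1_P_space_sum)
  have "\<exists>M. M \<in> derivatives ?Z \<and> (\<forall>x. (k, x) \<notin> M)" for k
    using derivatives_extend_to_sum[of "{}" Y k] empty_in_derivatives[OF assms(2,5)] by blast
  then have "\<forall>k. \<exists>M. M \<in> derivatives ?Z \<and> (\<forall>x. (k, x) \<notin> M)" by blast
  from choice[OF this] obtain M where M: "\<And>k. M k \<in> derivatives ?Z" "\<And>k x. (k, x) \<notin> M k" by blast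
  have "(\<Inter>k. M k) \<in> derivatives ?Z" using M(1) by (rule derivatives.limit)
  moreover have "(\<Inter>k. M k) = {}" using M(2) by auto
  ultimately have "\<not> Z.bad (\<lambda>k. {k} \<times> topspace (Y k))" using Z.no_bad_sequence by simp
  moreover have "openin ?Z ({k} \<times> topspace (Y k))" for k
  proof -
    have "{x. (i, x) \<in> {k} \<times> topspace (Y k)} = (if i = k then topspace (Y k) else {})" for i by auto
    then show ?thesis unfolding openin_sum_topology by auto
  qed
  ultimately obtain i j where ij: "i < j" and fit: "fits ?Z ({i} \<times> topspace (Y i)) ({j} \<times> topspace (Y j))"
    unfolding Z.bad_def by blast
  from fit have "Y i embeds_in Y j" by (rule fits_components_imp_embeds_in)
  with ij show ?thesis by blast
qed

section \<open>Antichains and decreasing chains\<close>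

theorem corollary31:
  fixes \<F> :: "'a topology set"
  assumes "\<And>X. X \<in> \<F> \<Longrightarrow> regular_space X \<and> t1_space X"
    and "\<And>X. X \<in> \<F> \<Longrightarrow> scattered X"
    and "\<And>X. X \<in> \<F> \<Longrightarrow> P_space X"
    and "\<And>X. X \<in> \<F> \<Longrightarrow> weight X =o cardSuc natLeq"
    and "\<And>X. X \<in> \<F> \<Longrightarrow> countable (Field (cb_rank X))"
  shows "(\<forall>\<A> \<subseteq> \<F>. hantichain \<A> \<longrightarrow> finite \<A>) \<and>
    \<not> (\<exists>X :: nat \<Rightarrow> 'a topology. range X \<subseteq> \<F> \<and> strictly_decreasing_chain X)"
proof -
  have seq: "\<exists>i j. i < j \<and> Y i embeds_in Y j" if "range Y \<subseteq> \<F>" for Y :: "nat \<Rightarrow> 'a topology"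
  proof (rule embedding_in_sequence)
    have "Y k \<in> \<F>" for k using that by blast
    then show "regular_space (Y k) \<and> t1_space (Y k)" "scattered (Y k)" "P_space (Y k)"
      "weight (Y k) =o cardSuc natLeq" "countable (Field (cb_rank (Y k)))" for k
      using assms by blast+
  qed
  show ?thesis
  proof (intro conjI allI impI notI)
    fix \<A> assume A: "\<A> \<subseteq> \<F>" and anti: "hantichain \<A>"
    show "finite \<A>"
    proof (rule ccontr)
      assume "infinite \<A>"
      then obtain Y :: "nat \<Rightarrow> 'a topology" where Y: "inj Y" "range Y \<subseteq> \<A>"
        using infinite_countable_subset by blast
      then obtain i j where ij: "i < j" "Y i embeds_in Y j" using seq A by (meson order_trans)
      have "Y i \<noteq> Y j" using Y(1) ij(1) by (simp add: inj_eq)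
      then show False using anti Y(2) ij(2) unfolding hantichain_def pairwise_def by blast
    qed
  next
    assume "\<exists>X :: nat \<Rightarrow> 'a topology. range X \<subseteq> \<F> \<and> strictly_decreasing_chain X"
    then obtain Y :: "nat \<Rightarrow> 'a topology" where Y: "range Y \<subseteq> \<F>" "strictly_decreasing_chain Y" by blast
    obtain i j where ij: "i < j" "Y i embeds_in Y j" using seq[OF Y(1)] by blast
    have down: "Y (Suc k) embeds_in Y k" for k using Y(2) unfolding strictly_decreasing_chain_def by blast
    have "Y j embeds_in Y (Suc i)" using Suc_leI[OF ij(1)]
    proof (induction j rule: dec_induct)
      case base
      show ?case unfolding embeds_def by (rule exI[of _ "topspace (Y (Suc i))"]) simp
    next
      case (step n)
      then show ?case using down embeds_in_trans by blast
    qed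
    then have "Y i embeds_in Y (Suc i)" using ij(2) embeds_in_trans by blast
    then have "biembeddable (Y (Suc i)) (Y i)" using down unfolding biembeddable_def by blast
    then show False using Y(2) unfolding strictly_decreasing_chain_def by blast
  qed
qed

end
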